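(* Let $n\ge 2$ and let $I\in\mathbb{C}\mathrm{P}^n$ be a fixed point. Then the fundamental group of the space $\mathcal{D}_I^{2,n}$ of planar Desargues configurations in $\mathbb{C}\mathrm{P}^n$ with fixed intersection point $I$ is $$\pi_1(\mathcal{D}_{I}^{2,n})\cong\begin{cases}\mathbb{Z}\oplus\mathbb{Z}\oplus\mathbb{Z} & \text{if } n=2,\\ \mathbb{Z}\oplus\mathbb{Z} & \text{if } n\geq 3.\end{cases}$$
   Context: For six points $A_1,B_1,A_2,B_2,A_3,B_3\in\mathbb{C}\mathrm{P}^n$ with $A_i\neq B_i$, let $d_i$ denote the projective line through $A_i$ and $B_i$. For $n\ge 2$, $\mathcal{D}^{2,n}$ is the set of 6-tuples $(A_1,B_1,A_2,B_2,A_3,B_3)$ of pairwise distinct points of $\mathbb{C}\mathrm{P}^n$ such that: the six points span a projective subspace of dimension $2$; the lines $d_1,d_2,d_3$ are pairwise distinct and concurrent, $d_1\cap d_2\cap d_3$ being a single point; and $A_i,B_i\in d_i\setminus (d_1\cap d_2\cap d_3)$ for $i=1,2,3$. For a fixed point $I\in\mathbb{C}\mathrm{P}^n$, $\mathcal{D}_I^{2,n}$ is the subset of $\mathcal{D}^{2,n}$ of those configurations with $d_1\cap d_2\cap d_3=\{I\}$. Both have the subspace topology from $(\mathbb{C}\mathrm{P}^n)^6$. *)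

theory Defs
  imports "HOL-Analysis.Analysis" "HOL-Algebra.Elementary_Groups"
begin

section \<open>Complex projective space\<close>

text \<open>
  The points of \<open>'n cproj\<close> are the one-dimensional complex linear subspaces of
  \<open>complex^'n\<close>; the type is therefore the projective space of complex dimension
  \<open>CARD('n) - 1\<close>. The constants prefixed with \<open>vec\<close> are linear algebra over the field of
  scalars (here the complex numbers), unlike the unprefixed ones, which are linear algebra
  over the reals.
\<close>

typedef 'n cproj = "{L :: (complex^'n::finite) set. vec.subspace L \<and> vec.dim L = 1}"
  morphisms cproj_space Abs_cproj
proof
  show "vec.span {axis undefined 1 :: complex^'n}
          \<in> {L. vec.subspace L \<and> vec.dim L = 1}"
    by (simp add: vec.subspace_span axis_eq_0_iff)
qed

definition cproj_of :: "complex^'n::finite \<Rightarrow> 'n cproj" where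
  "cproj_of v = Abs_cproj (vec.span {v})"

lemma cproj_space_cproj_of:
  assumes "v \<noteq> 0"
  shows "cproj_space (cproj_of v) = vec.span {v}"
  using assms by (simp add: cproj_of_def Abs_cproj_inverse vec.subspace_span)

text \<open>The quotient topology along \<open>cproj_of\<close>, restricted to the nonzero vectors.\<close>

instantiation cproj :: (finite) topological_space
begin

definition open_cproj :: "'a cproj set \<Rightarrow> bool" where
  "open U \<longleftrightarrow>
     openin (top_of_set (- {0})) {v :: complex^'a. v \<noteq> 0 \<and> cproj_of v \<in> U}"

instance
proof
  have *: "open U \<longleftrightarrow> open {v :: complex^'a. v \<noteq> 0 \<and> cproj_of v \<in> U}"
    for U :: "'a cproj set"
    unfolding open_cproj_def openin_open_eq[OF open_Compl[OF closed_singleton]] by blast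
  show "open (UNIV :: 'a cproj set)"
    by (simp add: * open_Collect_neq)
  show "open (S \<inter> T)" if "open S" "open T" for S T :: "'a cproj set"
  proof -
    have "{v :: complex^'a. v \<noteq> 0 \<and> cproj_of v \<in> S \<inter> T}
        = {v. v \<noteq> 0 \<and> cproj_of v \<in> S} \<inter> {v. v \<noteq> 0 \<and> cproj_of v \<in> T}"
      by auto
    then show ?thesis
      using that by (simp add: * open_Int)
  qed
  show "open (\<Union>K)" if "\<forall>S\<in>K. open S" for K :: "'a cproj set set"
  proof -
    have "{v :: complex^'a. v \<noteq> 0 \<and> cproj_of v \<in> \<Union>K}
        = (\<Union>S\<in>K. {v. v \<noteq> 0 \<and> cproj_of v \<in> S})"
      by auto
    then show ?thesis
      using that by (simp add: * open_UN)
  qed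
qed

end

definition proj_span :: "'n::finite cproj set \<Rightarrow> 'n cproj set" where
  "proj_span X = {P. cproj_space P \<subseteq> vec.span (\<Union>Q\<in>X. cproj_space Q)}"

text \<open>
  The dimension of a projective subspace, given as its set of points. The type is \<open>int\<close>
  so that the empty subspace has dimension \<open>-1\<close>.
\<close>

definition proj_dim :: "'n::finite cproj set \<Rightarrow> int" where
  "proj_dim W = int (vec.dim (\<Union>P\<in>W. cproj_space P)) - 1"

text \<open>This is a line only for \<open>A \<noteq> B\<close>.\<close>

definition proj_line :: "'n::finite cproj \<Rightarrow> 'n cproj \<Rightarrow> 'n cproj set" where
  "proj_line A B = proj_span {A, B}"

section \<open>Planar Desargues configurations\<close>

type_synonym 'n six_points =
  "'n cproj \<times> 'n cproj \<times> 'n cproj \<times> 'n cproj \<times> 'n cproj \<times> 'n cproj"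

definition planar_desargues :: "'n::finite six_points set" where
  "planar_desargues =
     {(A1, B1, A2, B2, A3, B3).
        distinct [A1, B1, A2, B2, A3, B3] \<and>
        proj_dim (proj_span {A1, B1, A2, B2, A3, B3}) = 2 \<and>
        (let d1 = proj_line A1 B1; d2 = proj_line A2 B2; d3 = proj_line A3 B3
         in distinct [d1, d2, d3] \<and>
            (\<exists>J. d1 \<inter> d2 \<inter> d3 = {J}) \<and>
            {A1, B1} \<subseteq> d1 - (d1 \<inter> d2 \<inter> d3) \<and>
            {A2, B2} \<subseteq> d2 - (d1 \<inter> d2 \<inter> d3) \<and>
            {A3, B3} \<subseteq> d3 - (d1 \<inter> d2 \<inter> d3))}"

definition planar_desargues_at :: "'n::finite cproj \<Rightarrow> 'n six_points set" where
  "planar_desargues_at I =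
     {(A1, B1, A2, B2, A3, B3) | A1 B1 A2 B2 A3 B3.
        (A1, B1, A2, B2, A3, B3) \<in> planar_desargues \<and>
        proj_line A1 B1 \<inter> proj_line A2 B2 \<inter> proj_line A3 B3 = {I}}"

section \<open>The fundamental group\<close>

definition loops_at :: "'a::topological_space set \<Rightarrow> 'a \<Rightarrow> (real \<Rightarrow> 'a) set" where
  "loops_at S x = {p. path p \<and> path_image p \<subseteq> S \<and> pathstart p = x \<and> pathfinish p = x}"

definition loop_class ::
    "'a::topological_space set \<Rightarrow> (real \<Rightarrow> 'a) \<Rightarrow> (real \<Rightarrow> 'a) set" where
  "loop_class S p = {q. homotopic_paths S p q}"

text \<open>
  The group of the subspace \<open>S\<close> based at \<open>x\<close>. Its elements are the classes of loops under
  homotopy relative to the endpoints.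
\<close>

definition fundamental_group ::
    "'a::topological_space set \<Rightarrow> 'a \<Rightarrow> (real \<Rightarrow> 'a) set monoid" where
  "fundamental_group S x =
     \<lparr>carrier = loop_class S ` loops_at S x,
      mult = (\<lambda>C D. \<Union>p\<in>C. \<Union>q\<in>D. loop_class S (p +++ q)),
      one = loop_class S (\<lambda>t. x)\<rparr>"

lemma fundamental_group_mult_classes:
  assumes "p \<in> loops_at S x" "q \<in> loops_at S x"
  shows "loop_class S p \<otimes>\<^bsub>fundamental_group S x\<^esub> loop_class S q = loop_class S (p +++ q)"
proof -
  have "loop_class S (p' +++ q') = loop_class S (p +++ q)"
    if "homotopic_paths S p p'" "homotopic_paths S q q'" for p' q'
  proof -
    have "homotopic_paths S (p +++ q) (p' +++ q')"
      using assms that by (intro homotopic_paths_join) (auto simp: loops_at_def)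
    then show ?thesis
      unfolding loop_class_def by (blast intro: homotopic_paths_trans homotopic_paths_sym)
  qed
  moreover have "p \<in> loop_class S p" "q \<in> loop_class S q"
    using assms by (auto simp: loop_class_def loops_at_def)
  ultimately have "(\<Union>p'\<in>loop_class S p. \<Union>q'\<in>loop_class S q. loop_class S (p' +++ q'))
      = loop_class S (p +++ q)"
    unfolding loop_class_def[of S p] loop_class_def[of S q] by blast
  then show ?thesis
    by (simp add: fundamental_group_def)
qed

end

theory Submission
  imports Defs "HOL-Complex_Analysis.Riemann_Mapping"
begin

text \<open>
  Write \<open>I\<close> as the class of a vector \<open>e\<close>. On a line through \<open>I\<close>, a pair of distinct points
  \<open>A\<close>, \<open>B\<close>, both different from \<open>I\<close>, has a relation \<open>e = x v + y w\<close> between representing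
  vectors, with both coefficients nonzero; so there is exactly one vector \<open>a\<close> with \<open>A = [a]\<close>
  and \<open>B = [a - e]\<close> (lemma \<open>pair_normal_form\<close>). A planar Desargues configuration at \<open>I\<close> is
  thus the same thing as three vectors \<open>a1\<close>, \<open>a2\<close>, \<open>a3\<close>, any two of which are independent
  together with \<open>e\<close>, and such that \<open>a3\<close> lies in the span of \<open>e\<close>, \<open>a1\<close>, \<open>a2\<close>. Writing
  \<open>a3 = \<gamma> e + \<alpha> a1 + \<beta> a2\<close>, where independence means \<open>\<alpha> \<noteq> 0\<close> and \<open>\<beta> \<noteq> 0\<close>, identifies the
  space of configurations with the product of two punctured planes, of the space \<open>X\<close> of pairs
  \<open>(a1, a2)\<close> such that \<open>e\<close>, \<open>a1\<close>, \<open>a2\<close> are independent, and of a complex line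
  (lemma \<open>homeomorphism_desargues_of_params\<close>).

  The two punctured planes contribute \<open>\<int> \<oplus> \<int>\<close>, because the winding number is a complete
  invariant of loops in a punctured plane. The space \<open>X\<close> makes the difference between the two
  cases. In a projective plane, the determinant of \<open>e\<close>, \<open>a1\<close>, \<open>a2\<close> and the projection to \<open>a1\<close>
  split \<open>X\<close> as the product of a third punctured plane and of a simply connected space (lemma
  \<open>fundamental_group_indep3\<close>). In higher dimensions the dependent pairs have real codimension
  at least \<open>4\<close>, so a loop in \<open>X\<close> can be contracted along the segments towards a point in
  general position, and \<open>X\<close> is simply connected (lemma \<open>simply_connected_indep3\<close>).
\<close>

section \<open>Computing fundamental groups\<close>

lemma loop_class_eq_iff:
  assumes "p \<in> loops_at S x" "q \<in> loops_at S x"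
  shows "loop_class S p = loop_class S q \<longleftrightarrow> homotopic_paths S p q"
proof
  have "q \<in> loop_class S q"
    using assms by (auto simp: loop_class_def loops_at_def)
  then show "homotopic_paths S p q" if "loop_class S p = loop_class S q"
    using that by (auto simp: loop_class_def)
  show "loop_class S p = loop_class S q" if "homotopic_paths S p q"
    using that unfolding loop_class_def
    by (blast intro: homotopic_paths_trans homotopic_paths_sym)
qed

lemma loops_at_homotopic:
  assumes "p \<in> loops_at S x" "homotopic_paths S p q"
  shows "q \<in> loops_at S x"
  using assms homotopic_paths_imp_pathstart[OF assms(2)] homotopic_paths_imp_pathfinish[OF assms(2)]
    homotopic_paths_imp_path[OF assms(2)] homotopic_paths_imp_subset[OF assms(2)]
  by (auto simp: loops_at_def)

lemma loops_at_join:
  assumes "p \<in> loops_at S x" "q \<in> loops_at S x"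
  shows "p +++ q \<in> loops_at S x"
  using assms by (auto simp: loops_at_def path_image_join)

lemma loops_at_compose:
  assumes "p \<in> loops_at S x" "continuous_on S f" "f ` S \<subseteq> T"
  shows "f \<circ> p \<in> loops_at T (f x)"
  using assms
  by (auto simp: loops_at_def path_image_compose pathstart_compose pathfinish_compose
      intro!: path_continuous_image elim: continuous_on_subset)

lemma loop_class_in_carrier:
  "p \<in> loops_at S x \<Longrightarrow> loop_class S p \<in> carrier (fundamental_group S x)"
  by (simp add: fundamental_group_def)

text \<open>
  A complete homotopy invariant of loops that turns concatenation into the product of \<open>G\<close>
  descends to the classes of loops. The isomorphisms from fundamental groups below all come from
  such invariants, which makes it unnecessary to verify group laws for concatenation.
\<close>

lemma fundamental_group_iso_of_invariant:
  fixes \<phi> :: "(real \<Rightarrow> 'a::topological_space) \<Rightarrow> 'b"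
  assumes into: "\<And>p. p \<in> loops_at S x \<Longrightarrow> \<phi> p \<in> carrier G"
    and onto: "\<And>g. g \<in> carrier G \<Longrightarrow> \<exists>p\<in>loops_at S x. \<phi> p = g"
    and complete: "\<And>p q. \<lbrakk>p \<in> loops_at S x; q \<in> loops_at S x\<rbrakk>
                    \<Longrightarrow> \<phi> p = \<phi> q \<longleftrightarrow> homotopic_paths S p q"
    and join: "\<And>p q. \<lbrakk>p \<in> loops_at S x; q \<in> loops_at S x\<rbrakk> \<Longrightarrow> \<phi> (p +++ q) = \<phi> p \<otimes>\<^bsub>G\<^esub> \<phi> q"
  shows "fundamental_group S x \<cong> G"
proof -
  define h where "h C = the_elem (\<phi> ` C)" for C
  have h: "h (loop_class S p) = \<phi> p" if p: "p \<in> loops_at S x" for p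
  proof -
    have "\<phi> q = \<phi> p" if "q \<in> loop_class S p" for q
      using that complete[OF p loops_at_homotopic[OF p]] by (auto simp: loop_class_def)
    moreover have "p \<in> loop_class S p"
      using p by (simp add: loop_class_def loops_at_def)
    ultimately have "\<phi> ` loop_class S p = {\<phi> p}"
      by blast
    then show ?thesis
      by (simp add: h_def)
  qed
  have carr: "carrier (fundamental_group S x) = loop_class S ` loops_at S x"
    by (simp add: fundamental_group_def)
  have "h \<in> iso (fundamental_group S x) G"
    unfolding iso_iff
  proof (intro conjI)
    show "h \<in> hom (fundamental_group S x) G"
      by (rule homI) (auto simp: carr h into join fundamental_group_mult_classes loops_at_join)
    show "h ` carrier (fundamental_group S x) = carrier G"
      unfolding carr image_image using into onto by (auto simp: h image_iff)
    show "inj_on h (carrier (fundamental_group S x))"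
      by (auto simp: inj_on_def carr h complete loop_class_eq_iff)
  qed
  then show ?thesis
    by (rule is_isoI)
qed

lemma fundamental_group_homeomorphic:
  assumes hom: "homeomorphism S T f g" and x: "x \<in> S"
  shows "fundamental_group S x \<cong> fundamental_group T (f x)"
proof -
  have f: "continuous_on S f" "f ` S = T" and g: "continuous_on T g" "g ` T = S"
    and gf: "\<And>u. u \<in> S \<Longrightarrow> g (f u) = u" and fg: "\<And>u. u \<in> T \<Longrightarrow> f (g u) = u"
    using hom by (auto simp: homeomorphism_def)
  have comp_f: "f \<circ> p \<in> loops_at T (f x)" if "p \<in> loops_at S x" for p
    using loops_at_compose[OF that] f by blast
  have comp_g: "g \<circ> p \<in> loops_at S x" if "p \<in> loops_at T (f x)" for p
    using loops_at_compose[OF that g(1)] g gf[OF x] by auto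
  show ?thesis
  proof (rule fundamental_group_iso_of_invariant[where \<phi> = "\<lambda>p. loop_class T (f \<circ> p)"])
    show "loop_class T (f \<circ> p) \<in> carrier (fundamental_group T (f x))" if "p \<in> loops_at S x" for p
      by (simp add: loop_class_in_carrier comp_f that)
    show "\<exists>p\<in>loops_at S x. loop_class T (f \<circ> p) = C"
      if C: "C \<in> carrier (fundamental_group T (f x))" for C
    proof -
      obtain q where q: "q \<in> loops_at T (f x)" "C = loop_class T q"
        using C by (auto simp: fundamental_group_def)
      have "homotopic_paths T (f \<circ> (g \<circ> q)) q"
        using q(1) comp_f[OF comp_g[OF q(1)]] fg
        by (intro homotopic_paths_eq) (auto simp: loops_at_def path_image_def image_subset_iff)
      then have "loop_class T (f \<circ> (g \<circ> q)) = C"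
        using q comp_f[OF comp_g[OF q(1)]] by (simp add: loop_class_eq_iff)
      then show ?thesis
        using comp_g[OF q(1)] by blast
    qed
    show "loop_class T (f \<circ> p) = loop_class T (f \<circ> q) \<longleftrightarrow> homotopic_paths S p q"
      if p: "p \<in> loops_at S x" and q: "q \<in> loops_at S x" for p q
      unfolding loop_class_eq_iff[OF comp_f[OF p] comp_f[OF q]]
    proof
      assume "homotopic_paths T (f \<circ> p) (f \<circ> q)"
      then have *: "homotopic_paths S (g \<circ> (f \<circ> p)) (g \<circ> (f \<circ> q))"
        by (rule homotopic_paths_continuous_image[OF _ g(1)]) (use g(2) in auto)
      have **: "homotopic_paths S r (g \<circ> (f \<circ> r))" if "r \<in> loops_at S x" for r
        using that gf
        by (intro homotopic_paths_eq) (auto simp: loops_at_def path_image_def image_subset_iff)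
      show "homotopic_paths S p q"
        by (rule homotopic_paths_trans[OF **[OF p] homotopic_paths_trans[OF * homotopic_paths_sym[OF **[OF q]]]])
    next
      assume "homotopic_paths S p q"
      then show "homotopic_paths T (f \<circ> p) (f \<circ> q)"
        by (rule homotopic_paths_continuous_image[OF _ f(1)]) (use f(2) in auto)
    qed
    show "loop_class T (f \<circ> (p +++ q))
        = loop_class T (f \<circ> p) \<otimes>\<^bsub>fundamental_group T (f x)\<^esub> loop_class T (f \<circ> q)"
      if "p \<in> loops_at S x" "q \<in> loops_at S x" for p q
      by (simp add: fundamental_group_mult_classes comp_f that path_compose_join)
  qed
qed

lemma homotopic_paths_Times_iff:
  "homotopic_paths (S \<times> T) p q
     \<longleftrightarrow> homotopic_paths S (fst \<circ> p) (fst \<circ> q) \<and> homotopic_paths T (snd \<circ> p) (snd \<circ> q)"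
proof (intro iffI conjI)
  assume h: "homotopic_paths (S \<times> T) p q"
  show "homotopic_paths S (fst \<circ> p) (fst \<circ> q)"
    by (rule homotopic_paths_continuous_image[OF h]) (auto intro: continuous_intros)
  show "homotopic_paths T (snd \<circ> p) (snd \<circ> q)"
    by (rule homotopic_paths_continuous_image[OF h]) (auto intro: continuous_intros)
next
  assume "homotopic_paths S (fst \<circ> p) (fst \<circ> q) \<and> homotopic_paths T (snd \<circ> p) (snd \<circ> q)"
  then have hS: "homotopic_paths S (fst \<circ> p) (fst \<circ> q)"
    and hT: "homotopic_paths T (snd \<circ> p) (snd \<circ> q)"
    by auto
  from hS obtain h where
    h: "continuous_on ({0..1} \<times> {0..1}) h" "h \<in> {0..1} \<times> {0..1} \<rightarrow> S"
      "\<forall>t\<in>{0..1}. h (0, t) = (fst \<circ> p) t" "\<forall>t\<in>{0..1}. h (1, t) = (fst \<circ> q) t"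
      "\<forall>s\<in>{0..1::real}. pathstart (h \<circ> Pair s) = pathstart (fst \<circ> p) \<and>
                  pathfinish (h \<circ> Pair s) = pathfinish (fst \<circ> p)"
    unfolding homotopic_paths by blast
  from hT obtain k where
    k: "continuous_on ({0..1} \<times> {0..1}) k" "k \<in> {0..1} \<times> {0..1} \<rightarrow> T"
      "\<forall>t\<in>{0..1}. k (0, t) = (snd \<circ> p) t" "\<forall>t\<in>{0..1}. k (1, t) = (snd \<circ> q) t"
      "\<forall>s\<in>{0..1::real}. pathstart (k \<circ> Pair s) = pathstart (snd \<circ> p) \<and>
                  pathfinish (k \<circ> Pair s) = pathfinish (snd \<circ> p)"
    unfolding homotopic_paths by blast
  show "homotopic_paths (S \<times> T) p q"
    unfolding homotopic_paths
  proof (intro exI[of _ "\<lambda>z. (h z, k z)"] conjI ballI)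
    show "continuous_on ({0..1} \<times> {0..1}) (\<lambda>z. (h z, k z))"
      using h(1) k(1) by (intro continuous_intros)
    show "(\<lambda>z. (h z, k z)) \<in> {0..1} \<times> {0..1} \<rightarrow> S \<times> T"
      using h(2) k(2) by auto
  qed (use h(3-5) k(3-5) in \<open>auto simp: pathstart_def pathfinish_def prod_eq_iff\<close>)
qed

lemma loops_at_Pair:
  assumes "p \<in> loops_at S x" "q \<in> loops_at T y"
  shows "(\<lambda>t. (p t, q t)) \<in> loops_at (S \<times> T) (x, y)"
  using assms
  by (auto simp: loops_at_def path_def path_image_def pathstart_def pathfinish_def
      intro!: continuous_intros)

lemma loops_at_Times_D:
  assumes "p \<in> loops_at (S \<times> T) (x, y)"
  shows "fst \<circ> p \<in> loops_at S x" "snd \<circ> p \<in> loops_at T y"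
proof -
  have "continuous_on (S \<times> T) fst" "fst ` (S \<times> T) \<subseteq> S"
    "continuous_on (S \<times> T) snd" "snd ` (S \<times> T) \<subseteq> T"
    by (auto intro: continuous_on_fst continuous_on_snd continuous_on_id)
  then show "fst \<circ> p \<in> loops_at S x" "snd \<circ> p \<in> loops_at T y"
    using loops_at_compose[OF assms, of fst S] loops_at_compose[OF assms, of snd T] by auto
qed

lemma fundamental_group_Times:
  "fundamental_group (S \<times> T) (x, y) \<cong> fundamental_group S x \<times>\<times> fundamental_group T y"
proof (rule fundamental_group_iso_of_invariant
    [where \<phi> = "\<lambda>p. (loop_class S (fst \<circ> p), loop_class T (snd \<circ> p))"])
  show "\<exists>p\<in>loops_at (S \<times> T) (x, y). (loop_class S (fst \<circ> p), loop_class T (snd \<circ> p)) = C"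
    if C: "C \<in> carrier (fundamental_group S x \<times>\<times> fundamental_group T y)" for C
  proof -
    obtain p q where pq: "p \<in> loops_at S x" "q \<in> loops_at T y" "C = (loop_class S p, loop_class T q)"
      using C by (auto simp: fundamental_group_def)
    then show ?thesis
      by (intro bexI[of _ "\<lambda>t. (p t, q t)"] loops_at_Pair) (auto simp: o_def)
  qed
next
  fix p q assume p: "p \<in> loops_at (S \<times> T) (x, y)" and q: "q \<in> loops_at (S \<times> T) (x, y)"
  note pq = loops_at_Times_D[OF p] loops_at_Times_D[OF q]
  show "(loop_class S (fst \<circ> p), loop_class T (snd \<circ> p)) = (loop_class S (fst \<circ> q), loop_class T (snd \<circ> q))
      \<longleftrightarrow> homotopic_paths (S \<times> T) p q"
    by (simp add: pq loop_class_eq_iff[OF pq(1,3)] loop_class_eq_iff[OF pq(2,4)] homotopic_paths_Times_iff)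
  show "(loop_class S (fst \<circ> (p +++ q)), loop_class T (snd \<circ> (p +++ q)))
      = (loop_class S (fst \<circ> p), loop_class T (snd \<circ> p)) \<otimes>\<^bsub>fundamental_group S x \<times>\<times> fundamental_group T y\<^esub>
        (loop_class S (fst \<circ> q), loop_class T (snd \<circ> q))"
    by (simp add: pq path_compose_join fundamental_group_mult_classes)
qed (simp add: loop_class_in_carrier loops_at_Times_D[where S = S and T = T])

text \<open>
  The first component of a loop is a complete invariant, since the second components of any
  two loops are homotopic in the simply connected factor.
\<close>

lemma fundamental_group_Times_simply_connected:
  fixes T :: "'b::real_normed_vector set"
  assumes T: "simply_connected T" and y: "y \<in> T"
  shows "fundamental_group (S \<times> T) (x, y) \<cong> fundamental_group S x"
proof (rule fundamental_group_iso_of_invariant[where \<phi> = "\<lambda>p. loop_class S (fst \<circ> p)"])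
  show "loop_class S (fst \<circ> p) = loop_class S (fst \<circ> q) \<longleftrightarrow> homotopic_paths (S \<times> T) p q"
    if pq: "p \<in> loops_at (S \<times> T) (x, y)" "q \<in> loops_at (S \<times> T) (x, y)" for p q
  proof -
    have "homotopic_paths T (snd \<circ> p) (snd \<circ> q)"
      using T loops_at_Times_D(2)[OF pq(1)] loops_at_Times_D(2)[OF pq(2)]
      by (auto simp: simply_connected_eq_homotopic_paths loops_at_def)
    then show ?thesis
      using pq by (simp add: loop_class_eq_iff[OF loops_at_Times_D(1) loops_at_Times_D(1)]
          homotopic_paths_Times_iff)
  qed
  show "\<exists>p\<in>loops_at (S \<times> T) (x, y). loop_class S (fst \<circ> p) = C"
    if C: "C \<in> carrier (fundamental_group S x)" for C
  proof -
    obtain p where p: "p \<in> loops_at S x" "C = loop_class S p"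
      using C by (auto simp: fundamental_group_def)
    have "(\<lambda>t. y) \<in> loops_at T y"
      using y by (auto simp: loops_at_def path_def path_image_def pathstart_def pathfinish_def)
    then show ?thesis
      using p by (intro bexI[of _ "\<lambda>t. (p t, y)"] loops_at_Pair) (auto simp: o_def)
  qed
next
  fix p q assume p: "p \<in> loops_at (S \<times> T) (x, y)" and q: "q \<in> loops_at (S \<times> T) (x, y)"
  note pq = loops_at_Times_D[OF p] loops_at_Times_D[OF q]
  show "loop_class S (fst \<circ> (p +++ q))
      = loop_class S (fst \<circ> p) \<otimes>\<^bsub>fundamental_group S x\<^esub> loop_class S (fst \<circ> q)"
    by (simp add: pq path_compose_join fundamental_group_mult_classes)
qed (blast intro: loop_class_in_carrier loops_at_Times_D(1))

lemma DirProd_iso_cong: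
  assumes "G \<cong> G'" "H \<cong> H'"
  shows "G \<times>\<times> H \<cong> G' \<times>\<times> H'"
proof -
  obtain f g where "f \<in> iso G G'" "g \<in> iso H H'"
    using assms by (auto simp: is_iso_def)
  then have "map_prod f g \<in> iso (G \<times>\<times> H) (G' \<times>\<times> H')"
    unfolding iso_iff
    by (intro conjI homI)
       (auto simp: hom_in_carrier hom_mult map_prod_surj_on inj_on_def)
  then show ?thesis
    by (rule is_isoI)
qed

text \<open>
  The winding number around the origin is a complete invariant of loops. The value \<open>k\<close> is
  attained by the exponential of the segment from a logarithm of \<open>z\<close> to its translate by
  \<open>2 \<pi> \<i> k\<close>. As winding numbers are complex by type, the floor of the real part is taken to
  obtain the integer that the winding number of a loop is.
\<close>

lemma fundamental_group_punctured_plane: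
  fixes z :: complex
  assumes "z \<noteq> 0"
  shows "fundamental_group (- {0}) z \<cong> integer_group"
proof (rule fundamental_group_iso_of_invariant[where \<phi> = "\<lambda>p. \<lfloor>Re (winding_number p 0)\<rfloor>"])
  have wind: "winding_number p 0 = of_int \<lfloor>Re (winding_number p 0)\<rfloor>"
    if "p \<in> loops_at (- {0}) z" for p
  proof -
    have "winding_number p 0 \<in> \<int>"
      using that by (intro integer_winding_number) (auto simp: loops_at_def)
    then show ?thesis
      by (auto elim: Ints_cases)
  qed
  show "\<lfloor>Re (winding_number p 0)\<rfloor> = \<lfloor>Re (winding_number q 0)\<rfloor> \<longleftrightarrow> homotopic_paths (- {0}) p q"
    if pq: "p \<in> loops_at (- {0}) z" "q \<in> loops_at (- {0}) z" for p q
  proof -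
    have "winding_number p 0 = winding_number q 0 \<longleftrightarrow> homotopic_paths (- {0}) p q"
      using pq by (intro winding_number_homotopic_paths_eq) (auto simp: loops_at_def)
    then show ?thesis
      using wind[OF pq(1)] wind[OF pq(2)] by metis
  qed
  show "\<lfloor>Re (winding_number (p +++ q) 0)\<rfloor>
      = \<lfloor>Re (winding_number p 0)\<rfloor> \<otimes>\<^bsub>integer_group\<^esub> \<lfloor>Re (winding_number q 0)\<rfloor>"
    if pq: "p \<in> loops_at (- {0}) z" "q \<in> loops_at (- {0}) z" for p q
  proof -
    have "winding_number (p +++ q) 0 = winding_number p 0 + winding_number q 0"
      using pq by (intro winding_number_join) (auto simp: loops_at_def)
    also have "\<dots> = of_int (\<lfloor>Re (winding_number p 0)\<rfloor> + \<lfloor>Re (winding_number q 0)\<rfloor>)"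
      using wind[OF pq(1)] wind[OF pq(2)] by simp
    finally show ?thesis
      by (simp only: complex_Re_of_int floor_of_int mult_integer_group)
  qed
  show "\<exists>p\<in>loops_at (- {0}) z. \<lfloor>Re (winding_number p 0)\<rfloor> = k" for k
  proof -
    define l where "l = linepath (Ln z) (Ln z + of_int k * (2 * of_real pi * \<i>))"
    have "exp (of_int k * (2 * of_real pi * \<i>) :: complex) = 1"
      using exp_integer_2pi[of "of_int k"] by (simp add: mult_ac)
    then have "exp \<circ> l \<in> loops_at (- {0}) z"
      using assms
      by (auto simp: loops_at_def l_def path_image_compose pathstart_compose pathfinish_compose
          exp_add intro!: path_continuous_image continuous_intros)
    moreover have "winding_number (exp \<circ> l) 0 = of_int k"
      by (subst winding_number_compose_exp) (auto simp: l_def)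
    ultimately show ?thesis
      by (intro bexI[of _ "exp \<circ> l"]) auto
  qed
qed auto

section \<open>Simple connectivity by general position\<close>

text \<open>
  A loop in an open set is homotopic to a polynomial loop \<open>p\<close>, and the cone over \<open>p\<close> with apex
  \<open>c\<close> contracts it as soon as no segment from \<open>c\<close> to a point \<open>p s\<close> meets the complement. If it
  meets it in \<open>f z = (1 - t) p s + t c\<close>, then \<open>c\<close> is the value at \<open>(z, s, 1 / t)\<close> of a
  differentiable map whose domain has two dimensions more than that of \<open>f\<close>. If the ambient
  dimension is larger still, such apices form a null set, and some apex suits any two given
  loops at once.
\<close>

lemma simply_connected_open_Compl_lowdim:
  fixes U :: "'b::euclidean_space set" and F :: "('a::euclidean_space \<Rightarrow> 'b) set"
  assumes U: "open U" and F: "countable F" and diff: "\<And>f. f \<in> F \<Longrightarrow> f differentiable_on UNIV"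
    and cover: "- U \<subseteq> (\<Union>f\<in>F. range f)" and dim: "DIM('a) + 2 < DIM('b)"
  shows "simply_connected U"
proof -
  \<comment> \<open>the apices of cones over \<open>p\<close> that meet the complement; \<open>r\<close> stands for \<open>1 / t\<close>\<close>
  define bad where "bad p = (\<Union>f\<in>F. range (\<lambda>(z, s, r). r *\<^sub>R f z + (1 - r) *\<^sub>R p s))"
    for p :: "real \<Rightarrow> 'b"
  have bad: "negligible (bad p)" if "polynomial_function p" for p
    unfolding bad_def
  proof (intro negligible_countable_Union countable_image F)
    fix N assume "N \<in> (\<lambda>f. range (\<lambda>(z, s, r). r *\<^sub>R f z + (1 - r) *\<^sub>R p s)) ` F"
    then obtain f where f: "f \<in> F"
      and N: "N = range (\<lambda>(z::'a, s::real, r::real). r *\<^sub>R f z + (1 - r) *\<^sub>R p s)"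
      by blast
    have "(\<lambda>(z::'a, s::real, r::real). r *\<^sub>R f z + (1 - r) *\<^sub>R p s) differentiable at x" for x
    proof -
      have "(\<lambda>x::'a \<times> real \<times> real. f (fst x)) differentiable at x"
        using diff[OF f]
        by (intro differentiable_chain_at[of fst x f, unfolded o_def])
           (auto simp: differentiable_on_def bounded_linear_imp_differentiable bounded_linear_fst)
      moreover have "(\<lambda>x::'a \<times> real \<times> real. fst (snd x)) differentiable at x"
        by (auto intro!: bounded_linear_imp_differentiable bounded_linear_fst_comp bounded_linear_snd)
      then have "(\<lambda>x::'a \<times> real \<times> real. p (fst (snd x))) differentiable at x"
        by (rule differentiable_chain_at[of "\<lambda>x. fst (snd x)" x p, unfolded o_def])
           (rule differentiable_at_polynomial_function[OF that])
      moreover have "(\<lambda>x::'a \<times> real \<times> real. snd (snd x)) differentiable at x"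
        by (auto intro!: bounded_linear_imp_differentiable bounded_linear_snd_comp bounded_linear_snd)
      ultimately show ?thesis
        unfolding case_prod_unfold
        by (intro differentiable_add differentiable_scaleR differentiable_diff) auto
    qed
    then show "negligible N"
      unfolding N using dim
      by (intro negligible_differentiable_image_lowdim)
         (auto simp: differentiable_on_def intro: differentiable_at_withinI)
  qed
  have smooth: "\<exists>p'. polynomial_function p' \<and> pathfinish p' = pathstart p' \<and>
       path_image p' \<subseteq> U \<and> homotopic_loops U p p'"
    if p: "path p" "path_image p \<subseteq> U" "pathfinish p = pathstart p" for p
  proof -
    obtain e where "e > 0" and e: "\<And>h. \<lbrakk>path h; pathfinish h = pathstart h;
        \<forall>t\<in>{0..1}. norm (h t - p t) < e\<rbrakk> \<Longrightarrow> homotopic_loops U p h"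
      using homotopic_nearby_loops[OF p(1) U p(2,3)] by blast
    obtain p' where p': "polynomial_function p'" "pathstart p' = pathstart p"
        "pathfinish p' = pathfinish p" "\<And>t. t \<in> {0..1} \<Longrightarrow> norm (p' t - p t) < e"
      using path_approx_polynomial_function[OF p(1) \<open>e > 0\<close>] by metis
    have "homotopic_loops U p p'"
      using p p' by (intro e) (auto simp: path_polynomial_function)
    then show ?thesis
      using p p' homotopic_loops_imp_subset by metis
  qed
  have cone: "homotopic_loops U p (linepath c c)"
    if p: "polynomial_function p" "pathfinish p = pathstart p" "path_image p \<subseteq> U"
      and c: "c \<notin> bad p" for p c
  proof (rule homotopic_loops_linear)
    fix t :: real assume t: "t \<in> {0..1}"
    show "closed_segment (p t) (linepath c c t) \<subseteq> U"
    proof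
      fix x assume "x \<in> closed_segment (p t) (linepath c c t)"
      then obtain u where u: "0 \<le> u" "u \<le> 1" and x: "x = (1 - u) *\<^sub>R p t + u *\<^sub>R c"
        by (auto simp: in_segment)
      show "x \<in> U"
      proof (rule ccontr)
        assume "x \<notin> U"
        then obtain f z where fz: "f \<in> F" "x = f z"
          using cover by blast
        have "u \<noteq> 0"
          using \<open>x \<notin> U\<close> p(3) t by (auto simp: x path_image_def image_subset_iff)
        \<comment> \<open>solving \<open>f z = (1 - u) p t + u c\<close> for \<open>c\<close>\<close>
        have "u *\<^sub>R c = f z - (1 - u) *\<^sub>R p t"
          using x fz(2) by simp
        then have "inverse u *\<^sub>R u *\<^sub>R c = inverse u *\<^sub>R f z - (inverse u * (1 - u)) *\<^sub>R p t"
          by (simp add: scaleR_right_diff_distrib)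
        moreover have "inverse u * (1 - u) = inverse u - 1"
          using \<open>u \<noteq> 0\<close> by (simp add: field_simps)
        ultimately have "c = inverse u *\<^sub>R f z + (1 - inverse u) *\<^sub>R p t"
          using \<open>u \<noteq> 0\<close> by (simp add: scaleR_left_diff_distrib)
        then have "c \<in> bad p"
          unfolding bad_def using fz(1)
          by (intro UN_I[of f] range_eqI[of _ _ "(z, t, inverse u)"]) auto
        with c show False ..
      qed
    qed
  qed (use p in \<open>auto simp: path_polynomial_function\<close>)
  show ?thesis
    unfolding simply_connected_def
  proof (intro allI impI)
    fix p q
    assume "path p \<and> pathfinish p = pathstart p \<and> path_image p \<subseteq> U \<and>
            path q \<and> pathfinish q = pathstart q \<and> path_image q \<subseteq> U"
    then obtain p' q' where
      p': "polynomial_function p'" "pathfinish p' = pathstart p'" "path_image p' \<subseteq> U"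
          "homotopic_loops U p p'" and
      q': "polynomial_function q'" "pathfinish q' = pathstart q'" "path_image q' \<subseteq> U"
          "homotopic_loops U q q'"
      using smooth by metis
    have "negligible (bad p' \<union> bad q')"
      using bad p' q' by auto
    then obtain c where "c \<notin> bad p' \<union> bad q'"
      using non_negligible_UNIV by (metis UNIV_eq_I)
    then have "homotopic_loops U p' (linepath c c)" "homotopic_loops U q' (linepath c c)"
      using cone[OF p'(1-3)] cone[OF q'(1-3)] by auto
    then have "homotopic_loops U p (linepath c c)" "homotopic_loops U (linepath c c) q"
      using p'(4) q'(4) homotopic_loops_trans homotopic_loops_sym by blast+
    then show "homotopic_loops U p q"
      by (rule homotopic_loops_trans)
  qed
qed

section \<open>Independent pairs and triples of complex vectors\<close>

lemma bounded_bilinear_vector_smult: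
  "bounded_bilinear (\<lambda>c (v :: complex^'n). c *s v)"
proof (rule bounded_bilinear.intro)
  show "\<exists>K. \<forall>(c::complex) (v::complex^'n). norm (c *s v) \<le> norm c * norm v * K"
  proof (intro exI[of _ 1] allI)
    fix c :: complex and v :: "complex^'n"
    show "norm (c *s v) \<le> norm c * norm v * 1"
      by (simp add: norm_vec_def norm_mult L2_set_right_distrib)
  qed
qed (auto simp: vec_eq_iff algebra_simps)

lemmas continuous_on_vector_smult [continuous_intros] =
  bounded_bilinear.continuous_on[OF bounded_bilinear_vector_smult]

lemma eq_smult_of_add_smult_eq_0:
  fixes w :: "complex^'n"
  assumes "a + z *s w = 0" "z \<noteq> 0"
  shows "w = (- 1 / z) *s a"
proof -
  have "(1 / z) *s (a + z *s w) = 0"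
    using assms by simp
  then have "(1 / z) *s a + w = 0"
    using assms(2) by (simp add: vec.scale_right_distrib)
  then show ?thesis
    by (simp add: eq_neg_iff_add_eq_0 add.commute)
qed

text \<open>
  The Hermitian form, linear in its first argument. Unlike for the real inner product,
  orthogonality with respect to it is a complex linear condition.
\<close>

definition herm :: "complex^'n \<Rightarrow> complex^'n \<Rightarrow> complex" where
  "herm v w = (\<Sum>k\<in>UNIV. v $ k * cnj (w $ k))"

lemma continuous_on_herm [continuous_intros]:
  "continuous_on S f \<Longrightarrow> continuous_on S g \<Longrightarrow> continuous_on S (\<lambda>x. herm (f x) (g x))"
  unfolding herm_def by (intro continuous_intros)

lemma herm_add_left: "herm (u + v) w = herm u w + herm v w"
  and herm_diff_left: "herm (u - v) w = herm u w - herm v w"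
  and herm_smult_left: "herm (c *s v) w = c * herm v w"
  and herm_zero_left: "herm 0 w = 0"
  and herm_commute: "herm w v = cnj (herm v w)"
  by (simp_all add: herm_def algebra_simps sum.distrib sum_subtractf sum_distrib_left)

lemmas herm_linear = herm_add_left herm_diff_left herm_smult_left herm_zero_left

lemma herm_self_eq_0_iff: "herm v v = 0 \<longleftrightarrow> v = 0"
proof -
  have "herm v v = of_real (\<Sum>k\<in>UNIV. (norm (v $ k))\<^sup>2)"
    by (simp add: herm_def complex_mult_cnj cmod_power2)
  then show ?thesis
    by (simp only: of_real_eq_0_iff) (simp add: sum_nonneg_eq_0_iff vec_eq_iff)
qed

text \<open>
  The component of \<open>v\<close> orthogonal to \<open>u\<close>, that is, one step of the Gram--Schmidt process. It
  equals \<open>v\<close> if \<open>u = 0\<close>.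
\<close>

definition reject :: "complex^'n \<Rightarrow> complex^'n \<Rightarrow> complex^'n" where
  "reject u v = v - (herm v u / herm u u) *s u"

lemma continuous_on_reject [continuous_intros]:
  assumes "continuous_on S f" "continuous_on S g" "\<And>x. x \<in> S \<Longrightarrow> f x \<noteq> 0"
  shows "continuous_on S (\<lambda>x. reject (f x) (g x))"
  unfolding reject_def using assms by (intro continuous_intros) (auto simp: herm_self_eq_0_iff)

lemma herm_reject: "u \<noteq> 0 \<Longrightarrow> herm u (reject u v) = 0"
proof -
  assume "u \<noteq> 0"
  then have "herm (reject u v) u = 0"
    by (simp add: reject_def herm_linear herm_self_eq_0_iff)
  then show ?thesis
    by (subst herm_commute) simp
qed

lemma herm_reject_same: "u \<noteq> 0 \<Longrightarrow> herm v (reject u v) = herm (reject u v) (reject u v)"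
proof -
  assume u: "u \<noteq> 0"
  have "herm (reject u v) (reject u v) = herm (v - (herm v u / herm u u) *s u) (reject u v)"
    by (simp only: reject_def[of u v])
  also have "\<dots> = herm v (reject u v)"
    using u by (simp add: herm_linear herm_reject)
  finally show ?thesis ..
qed

text \<open>
  Independence is expressed by the coefficients, and not by the set of the vectors, so that
  a pair or triple with repetitions counts as dependent.
\<close>

definition indep2 :: "complex^'n \<Rightarrow> complex^'n \<Rightarrow> bool" where
  "indep2 u v \<longleftrightarrow> (\<forall>x y. x *s u + y *s v = 0 \<longrightarrow> x = 0 \<and> y = 0)"

definition indep3 :: "complex^'n \<Rightarrow> complex^'n \<Rightarrow> complex^'n \<Rightarrow> bool" where
  "indep3 u v w \<longleftrightarrow> (\<forall>x y z. x *s u + y *s v + z *s w = 0 \<longrightarrow> x = 0 \<and> y = 0 \<and> z = 0)"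

lemma indep2_iff_reject: "indep2 u v \<longleftrightarrow> u \<noteq> 0 \<and> reject u v \<noteq> 0"
proof (intro iffI conjI notI)
  assume i: "indep2 u v"
  show False if "u = 0"
    using i that unfolding indep2_def by (auto dest: spec[of _ 1] spec[of _ 0])
  show False if "reject u v = 0"
  proof -
    have "(- (herm v u / herm u u)) *s u + 1 *s v = 0"
      using that by (simp add: reject_def vec.scale_left_diff_distrib)
    then show False
      using i unfolding indep2_def by (metis one_neq_zero)
  qed
next
  assume r: "u \<noteq> 0 \<and> reject u v \<noteq> 0"
  show "indep2 u v"
    unfolding indep2_def
  proof (intro allI impI)
    fix x y assume eq: "x *s u + y *s v = 0"
    have "herm (x *s u + y *s v) (reject u v) = 0"
      by (simp add: eq herm_linear)
    then have "y = 0"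
      using r by (simp add: herm_linear herm_reject herm_reject_same herm_self_eq_0_iff)
    then show "x = 0 \<and> y = 0"
      using eq r by simp
  qed
qed

text \<open>
  Rejecting from \<open>u\<close> kills multiples of \<open>u\<close> only, and so reduces the independence of three
  vectors to that of two.
\<close>

lemma indep3_iff_reject:
  "indep3 u v w \<longleftrightarrow> indep2 u v \<and> reject (reject u v) (reject u w) \<noteq> 0"
proof -
  have "indep3 u v w \<longleftrightarrow> u \<noteq> 0 \<and> indep2 (reject u v) (reject u w)"
  proof (intro iffI conjI notI)
    assume i: "indep3 u v w"
    show False if "u = 0"
      using i that unfolding indep3_def by (metis add.right_neutral one_neq_zero vec.scale_zero_left vec.scale_zero_right)
    show "indep2 (reject u v) (reject u w)"
      unfolding indep2_def
    proof (intro allI impI)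
      fix y z assume "y *s reject u v + z *s reject u w = 0"
      then have "(- y * (herm v u / herm u u) - z * (herm w u / herm u u)) *s u + y *s v + z *s w = 0"
        by (simp add: reject_def vec_eq_iff algebra_simps)
      then show "y = 0 \<and> z = 0"
        using i unfolding indep3_def by blast
    qed
  next
    assume r: "u \<noteq> 0 \<and> indep2 (reject u v) (reject u w)"
    show "indep3 u v w"
      unfolding indep3_def
    proof (intro allI impI)
      fix x y z assume eq: "x *s u + y *s v + z *s w = 0"
      have rej: "reject u (x *s u + y *s v + z *s w) = y *s reject u v + z *s reject u w"
        using r by (simp add: reject_def herm_linear vec_eq_iff field_simps herm_self_eq_0_iff)
      have "y *s reject u v + z *s reject u w = 0"
        unfolding rej[symmetric] eq by (simp add: reject_def herm_linear)
      then have "y = 0 \<and> z = 0"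
        using r unfolding indep2_def by blast
      then show "x = 0 \<and> y = 0 \<and> z = 0"
        using eq r by simp
    qed
  qed
  then show ?thesis
    by (auto simp: indep2_iff_reject)
qed

text \<open>
  The coordinate with respect to the last basis vector. A formula in terms of the Hermitian
  form shows that it depends continuously on the basis as well as on the vector, also when the
  plane or space that they span varies.
\<close>

definition coef2 :: "complex^'n \<Rightarrow> complex^'n \<Rightarrow> complex^'n \<Rightarrow> complex" where
  "coef2 u v z = herm z (reject u v) / herm v (reject u v)"

lemma coef2_eq:
  assumes "indep2 u v"
  shows "coef2 u v (x *s u + y *s v) = y"
  using assms
  by (simp add: coef2_def indep2_iff_reject herm_linear herm_reject herm_reject_same herm_self_eq_0_iff)

lemma continuous_on_coef2:
  assumes "continuous_on S f" "continuous_on S g" "continuous_on S h"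
    "\<And>x. x \<in> S \<Longrightarrow> indep2 (f x) (g x)"
  shows "continuous_on S (\<lambda>x. coef2 (f x) (g x) (h x))"
  unfolding coef2_def using assms
  by (intro continuous_intros) (auto simp: indep2_iff_reject herm_reject_same herm_self_eq_0_iff)

definition coef3 :: "complex^'n \<Rightarrow> complex^'n \<Rightarrow> complex^'n \<Rightarrow> complex^'n \<Rightarrow> complex" where
  "coef3 u v w z = coef2 (reject u v) (reject u w) (reject u z)"

lemma coef3_eq:
  assumes "indep3 u v w"
  shows "coef3 u v w (x *s u + y *s v + z *s w) = z"
proof -
  have "u \<noteq> 0" and i: "indep2 (reject u v) (reject u w)"
    using assms by (auto simp: indep3_iff_reject indep2_iff_reject)
  then have "reject u (x *s u + y *s v + z *s w) = y *s reject u v + z *s reject u w"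
    by (simp add: reject_def herm_linear vec_eq_iff field_simps herm_self_eq_0_iff)
  then show ?thesis
    by (simp add: coef3_def coef2_eq[OF i])
qed

lemma continuous_on_coef3:
  assumes "continuous_on S f" "continuous_on S g" "continuous_on S h" "continuous_on S k"
    "\<And>x. x \<in> S \<Longrightarrow> indep3 (f x) (g x) (h x)"
  shows "continuous_on S (\<lambda>x. coef3 (f x) (g x) (h x) (k x))"
  unfolding coef3_def using assms
  by (intro continuous_on_coef2 continuous_on_reject) (auto simp: indep3_iff_reject indep2_iff_reject)

lemma mem_span2: "z \<in> vec.span {u, v} \<longleftrightarrow> (\<exists>x y. z = x *s u + y *s v)"
proof -
  have "z - x *s u = y *s v \<longleftrightarrow> z = x *s u + y *s v" for x y
    by (auto simp: algebra_simps)
  then show ?thesis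
    by (simp add: vec.span_breakdown_eq[of z u] vec.span_singleton image_iff)
qed

lemma mem_span3: "t \<in> vec.span {u, v, w} \<longleftrightarrow> (\<exists>x y z. t = x *s u + y *s v + z *s w)"
proof -
  have "t - x *s u = y *s v + z *s w \<longleftrightarrow> t = x *s u + y *s v + z *s w" for x y z
    by (auto simp: algebra_simps)
  then show ?thesis
    by (simp add: vec.span_breakdown_eq[of t u] mem_span2)
qed

lemma indep2_iff_span: "indep2 u v \<longleftrightarrow> u \<noteq> 0 \<and> v \<notin> vec.span {u}"
proof
  assume i: "indep2 u v"
  have "u \<noteq> 0"
    using i by (simp add: indep2_iff_reject)
  moreover have "v \<noteq> c *s u" for c
  proof
    assume "v = c *s u"
    then have "c *s u + (- 1) *s v = 0"
      by simp
    then show False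
      using i unfolding indep2_def by (metis neg_equal_0_iff_equal one_neq_zero)
  qed
  ultimately show "u \<noteq> 0 \<and> v \<notin> vec.span {u}"
    by (auto simp: vec.span_singleton)
next
  assume r: "u \<noteq> 0 \<and> v \<notin> vec.span {u}"
  show "indep2 u v"
    unfolding indep2_def
  proof (intro allI impI)
    fix x y assume eq: "x *s u + y *s v = 0"
    have "y = 0"
    proof (rule ccontr)
      assume "y \<noteq> 0"
      then have "v = (- x / y) *s u"
        using eq_smult_of_add_smult_eq_0[OF eq] by simp
      then show False
        using r vec.span_scale[OF vec.span_base[of u "{u}"], of "- x / y"] by simp
    qed
    then show "x = 0 \<and> y = 0"
      using eq r by simp
  qed
qed

lemma indep3_iff_span: "indep3 u v w \<longleftrightarrow> indep2 u v \<and> w \<notin> vec.span {u, v}"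
proof
  assume i: "indep3 u v w"
  have "w \<noteq> c *s u + d *s v" for c d
  proof
    assume "w = c *s u + d *s v"
    then have "c *s u + d *s v + (- 1) *s w = 0"
      by simp
    then show False
      using i unfolding indep3_def by (metis neg_equal_0_iff_equal one_neq_zero)
  qed
  then show "indep2 u v \<and> w \<notin> vec.span {u, v}"
    using i by (auto simp: mem_span2 indep3_iff_reject)
next
  assume r: "indep2 u v \<and> w \<notin> vec.span {u, v}"
  show "indep3 u v w"
    unfolding indep3_def
  proof (intro allI impI)
    fix x y z assume eq: "x *s u + y *s v + z *s w = 0"
    have z: "z = 0"
    proof (rule ccontr)
      assume "z \<noteq> 0"
      then have "w = (- x / z) *s u + (- y / z) *s v"
        using eq_smult_of_add_smult_eq_0[OF eq] by (simp add: vec.scale_right_diff_distrib)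
      then show False
        using r mem_span2[of w u v] by blast
    qed
    then have "x = 0 \<and> y = 0"
      using eq r unfolding indep2_def by simp
    with z show "x = 0 \<and> y = 0 \<and> z = 0"
      by simp
  qed
qed

lemma dim_indep3: "indep3 u v w \<Longrightarrow> vec.dim {u, v, w} = 3"
proof -
  assume "indep3 u v w"
  then have "u \<noteq> 0" "v \<notin> vec.span {u}" "w \<notin> vec.span {v, u}"
    by (auto simp: indep3_iff_span indep2_iff_span insert_commute)
  then have "vec.dim {w, v, u} = 3"
    by (simp add: vec.dim_insert)
  then show ?thesis
    by (simp add: insert_commute)
qed

lemma indep3_swap_right: "indep3 u v w \<longleftrightarrow> indep3 u w v"
proof -
  have "indep3 u w v" if i: "indep3 u v w" for v w
    unfolding indep3_def
  proof (intro allI impI)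
    fix x y z assume "x *s u + y *s w + z *s v = 0"
    then have "x *s u + z *s v + y *s w = 0"
      by (simp add: add_ac)
    then show "x = 0 \<and> y = 0 \<and> z = 0"
      using i unfolding indep3_def by blast
  qed
  then show ?thesis
    by blast
qed

lemma indep3_swap_left: "indep3 u v w \<longleftrightarrow> indep3 v u w"
proof -
  have "indep3 v u w" if i: "indep3 u v w" for u v
    unfolding indep3_def
  proof (intro allI impI)
    fix x y z assume "x *s v + y *s u + z *s w = 0"
    then have "y *s u + x *s v + z *s w = 0"
      by (simp add: add_ac)
    then show "x = 0 \<and> y = 0 \<and> z = 0"
      using i unfolding indep3_def by blast
  qed
  then show ?thesis
    by blast
qed

lemma indep2_commute: "indep2 u v \<longleftrightarrow> indep2 v u"
  unfolding indep2_def by (metis add.commute)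

lemma indep2_diff:
  assumes "indep2 e a" shows "indep2 e (a - e)" "indep2 a (a - e)"
proof -
  have i: "x = 0 \<and> y = 0" if "x *s e + y *s a = 0" for x y
    using assms that by (simp add: indep2_def)
  show "indep2 e (a - e)"
    unfolding indep2_def
  proof (intro allI impI)
    fix x y assume "x *s e + y *s (a - e) = 0"
    then have "(x - y) *s e + y *s a = 0"
      by (simp add: vec_eq_iff algebra_simps)
    from i[OF this] show "x = 0 \<and> y = 0" by auto
  qed
  show "indep2 a (a - e)"
    unfolding indep2_def
  proof (intro allI impI)
    fix x y assume "x *s a + y *s (a - e) = 0"
    then have "(- y) *s e + (x + y) *s a = 0"
      by (simp add: vec_eq_iff algebra_simps)
    from i[OF this] show "x = 0 \<and> y = 0" by auto
  qed
qed

lemma indep2_nonzero: "indep2 e a \<Longrightarrow> e \<noteq> 0 \<and> a \<noteq> 0"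
  using indep2_commute[of e a] by (auto simp: indep2_iff_span)

lemma indep2_nonzero_diff:
  assumes "indep2 e a"
  shows "a \<noteq> 0" "a - e \<noteq> 0"
  using indep2_nonzero[OF assms] indep2_nonzero[OF indep2_diff(1)[OF assms]] by auto

section \<open>Pairs of vectors that are independent modulo a line\<close>

lemma open_indep3: "open {(v, w). indep3 e v w}"
proof (cases "e = 0")
  case True
  then have "{(v, w). indep3 e v w} = {}"
    by (auto simp: indep3_iff_reject indep2_iff_reject)
  then show ?thesis
    by simp
next
  case False
  let ?S = "{p. reject e (fst p) \<noteq> 0}"
  have "continuous_on UNIV (\<lambda>p. reject e (fst p))"
    using False by (intro continuous_intros) auto
  then have S: "open ?S"
    using open_Collect_neq[of "\<lambda>p. reject e (fst p)" "\<lambda>_. 0"] by auto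
  have "continuous_on ?S (\<lambda>p. reject (reject e (fst p)) (reject e (snd p)))"
    using False by (intro continuous_intros) auto
  then have "open (?S \<inter> (\<lambda>p. reject (reject e (fst p)) (reject e (snd p))) -` (- {0}))"
    by (rule continuous_open_preimage[OF _ S]) auto
  also have "?S \<inter> (\<lambda>p. reject (reject e (fst p)) (reject e (snd p))) -` (- {0}) = {(v, w). indep3 e v w}"
    using False by (auto simp: indep3_iff_reject indep2_iff_reject)
  finally show ?thesis .
qed

lemma differentiable_on_vector_smult:
  assumes "f differentiable_on S" "g differentiable_on S"
  shows "(\<lambda>x. f x *s g x :: complex^'n) differentiable_on S"
  using assms unfolding differentiable_on_def differentiable_def
  by (blast intro: bounded_bilinear.FDERIV[OF bounded_bilinear_vector_smult])

lemma differentiable_on_Pair: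
  assumes "f differentiable_on S" "g differentiable_on S"
  shows "(\<lambda>x. (f x, g x)) differentiable_on S"
  using assms unfolding differentiable_on_def differentiable_def
  by (blast intro: has_derivative_Pair)

text \<open>
  A dependent pair has the form \<open>(v, y e + x v)\<close> or \<open>(y e, v)\<close>. In complex dimension \<open>N\<close> the
  first family has \<open>2 N + 4\<close> real parameters (the second is given two redundant ones to share
  its domain), and \<open>2 N + 4 + 2 < 4 N\<close> for \<open>N \<ge> 4\<close>.
\<close>

lemma simply_connected_indep3:
  fixes e :: "complex^'n"
  assumes e: "e \<noteq> 0" and n: "CARD('n) \<ge> 4"
  shows "simply_connected {(v, w). indep3 e v w}"
proof -
  define f g :: "(complex^'n) \<times> complex \<times> complex \<Rightarrow> (complex^'n) \<times> (complex^'n)"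
    where "f = (\<lambda>z. (fst z, fst (snd z) *s e + snd (snd z) *s fst z))"
      and "g = (\<lambda>z. (fst (snd z) *s e, fst z))"
  show ?thesis
  proof (rule simply_connected_open_Compl_lowdim[where F = "{f, g}"])
    have [intro]: "fst differentiable_on (UNIV :: ((complex^'n) \<times> complex \<times> complex) set)"
      "(\<lambda>z. fst (snd z)) differentiable_on (UNIV :: ((complex^'n) \<times> complex \<times> complex) set)"
      "(\<lambda>z. snd (snd z)) differentiable_on (UNIV :: ((complex^'n) \<times> complex \<times> complex) set)"
      by (auto intro!: bounded_linear_imp_differentiable_on bounded_linear_fst bounded_linear_snd
          bounded_linear_fst_comp bounded_linear_snd_comp)
    show "h differentiable_on UNIV" if "h \<in> {f, g}" for h
      using that unfolding f_def g_def
      by (auto intro!: differentiable_on_Pair differentiable_on_add differentiable_on_vector_smult)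
    show "- {(v, w). indep3 e v w} \<subseteq> (\<Union>h\<in>{f, g}. range h)"
    proof
      fix p assume "p \<in> - {(v, w). indep3 e v w}"
      then obtain v w where p: "p = (v, w)" "\<not> indep3 e v w"
        by auto
      then obtain x y z where eq: "x *s e + y *s v + z *s w = 0"
        and nz: "x \<noteq> 0 \<or> y \<noteq> 0 \<or> z \<noteq> 0"
        unfolding indep3_def by blast
      show "p \<in> (\<Union>h\<in>{f, g}. range h)"
      proof (cases "z = 0")
        case False
        then have "w = (- x / z) *s e + (- y / z) *s v"
          using eq_smult_of_add_smult_eq_0[OF eq] by (simp add: vec.scale_right_diff_distrib)
        then have "p = f (v, - x / z, - y / z)"
          by (simp add: p f_def)
        then show ?thesis
          by blast
      next
        case True
        then have "y \<noteq> 0"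
          using nz eq e by auto
        then have "v = (- x / y) *s e"
          using eq_smult_of_add_smult_eq_0[of "x *s e" y v] eq True by simp
        then have "p = g (w, - x / y, 0)"
          by (simp add: p g_def)
        then show ?thesis
          by blast
      qed
    qed
    show "DIM((complex^'n) \<times> complex \<times> complex) + 2 < DIM((complex^'n) \<times> (complex^'n))"
      using n by simp
  qed (simp_all add: open_indep3)
qed

text \<open>
  Choose coordinates with \<open>e $ k \<noteq> 0\<close>. The functionals \<open>X\<close> and \<open>Y\<close> below are coordinates on the
  quotient by \<open>e\<close>, so that independence of \<open>e\<close>, \<open>v\<close>, \<open>w\<close> means that the determinant
  \<open>d = X v * Y w - X w * Y v\<close> is nonzero. For a fixed nonzero \<open>q = (X v, Y v)\<close>, the plane is
  spanned by \<open>q\<close> and the orthogonal vector \<open>(- cnj (Y v), cnj (X v))\<close>, and the coefficient of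
  \<open>(X w, Y w)\<close> along the latter is \<open>d\<close> divided by the square of the norm of \<open>q\<close>. Hence \<open>d\<close>,
  \<open>q\<close>, the other coefficient \<open>t\<close> and the \<open>k\<close>-th entries of \<open>v\<close> and \<open>w\<close> are independent
  coordinates; all factors other than the punctured plane of \<open>d\<close> are simply connected.
\<close>

lemma fundamental_group_indep3:
  fixes e :: "complex^'n"
  assumes n: "CARD('n) = 3" and p: "p \<in> {(v, w). indep3 e v w}"
  shows "fundamental_group {(v, w). indep3 e v w} p \<cong> integer_group"
proof -
  have "e \<noteq> 0"
    using p by (auto simp: indep3_iff_reject indep2_iff_reject)
  then obtain k where k: "e $ k \<noteq> 0"
    by (auto simp: vec_eq_iff)
  have "card (UNIV - {k}) = 2"
    using n by simp
  then obtain i j where ij: "UNIV - {k} = {i, j}" "i \<noteq> j"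
    unfolding card_2_iff by blast
  then have ijk: "i \<noteq> k" "j \<noteq> k" and UNIV: "l = i \<or> l = j \<or> l = k" for l
    by auto
  define X Y where "X v = v $ i * e $ k - v $ k * e $ i" and "Y v = v $ j * e $ k - v $ k * e $ j"
    for v :: "complex^'n"
  \<comment> \<open>the vector with \<open>X\<close>-value \<open>x\<close>, \<open>Y\<close>-value \<open>y\<close> and \<open>k\<close>-th entry \<open>z\<close>\<close>
  define mk where "mk x y z = (\<chi> l. if l = k then z else if l = i then (x + z * e $ i) / e $ k
      else (y + z * e $ j) / e $ k)" for x y z :: complex
  have mk: "X (mk x y z) = x" "Y (mk x y z) = y" "mk x y z $ k = z" for x y z
    using ijk ij(2) k by (auto simp: X_def Y_def mk_def)
  have mk_eta: "mk (X v) (Y v) (v $ k) = v" for v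
    using k UNIV by (auto simp: X_def Y_def mk_def vec_eq_iff)
  have lin: "X (x *s u + y *s v) = x * X u + y * X v" "Y (x *s u + y *s v) = x * Y u + y * Y v"
    for x y u v
    by (simp_all add: X_def Y_def algebra_simps)
  have Xe: "X e = 0" "Y e = 0"
    by (simp_all add: X_def Y_def)
  have ker: "v = (v $ k / e $ k) *s e" if "X v = 0" "Y v = 0" for v
    unfolding vec_eq_iff
  proof
    fix l
    show "v $ l = ((v $ k / e $ k) *s e) $ l"
      using that k UNIV[of l] by (auto simp: X_def Y_def field_simps)
  qed
  have indep: "indep3 e v w \<longleftrightarrow> X v * Y w - X w * Y v \<noteq> 0" for v w
  proof
    assume i: "indep3 e v w"
    have dep: "y = 0 \<and> z = 0" if "y * X v + z * X w = 0" "y * Y v + z * Y w = 0" for y z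
    proof -
      let ?u = "y *s v + z *s w"
      have "?u = (?u $ k / e $ k) *s e"
        using that by (intro ker) (simp_all add: lin)
      then have "(- (?u $ k / e $ k)) *s e + y *s v + z *s w = 0"
        by (metis add.assoc add.left_inverse vec.scale_minus_left)
      then show ?thesis
        using i unfolding indep3_def by blast
    qed
    show "X v * Y w - X w * Y v \<noteq> 0"
    proof
      assume d: "X v * Y w - X w * Y v = 0"
      \<comment> \<open>up to sign, the columns of the adjugate matrix are relations modulo \<open>e\<close>\<close>
      have "Y w = 0 \<and> - Y v = 0"
        using d by (intro dep) (simp_all add: algebra_simps)
      moreover have "X w = 0 \<and> - X v = 0"
        using d by (intro dep) (simp_all add: algebra_simps)
      ultimately show False
        using dep[of 1 0] by simp
    qed
  next
    assume d: "X v * Y w - X w * Y v \<noteq> 0"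
    show "indep3 e v w"
      unfolding indep3_def
    proof (intro allI impI)
      fix x y z assume eq: "x *s e + y *s v + z *s w = 0"
      have "X (1 *s (x *s e + y *s v) + z *s w) = 0" "Y (1 *s (x *s e + y *s v) + z *s w) = 0"
        by (simp_all add: eq) (simp_all add: X_def Y_def)
      then have yz: "y * X v + z * X w = 0" "y * Y v + z * Y w = 0"
        by (simp_all only: lin Xe) simp_all
      have "y * (X v * Y w - X w * Y v) = (y * X v + z * X w) * Y w - (y * Y v + z * Y w) * X w"
        "z * (X v * Y w - X w * Y v) = (y * Y v + z * Y w) * X v - (y * X v + z * X w) * Y v"
        by (simp_all add: algebra_simps)
      then have "y = 0" "z = 0"
        using d by (simp_all add: yz)
      then show "x = 0 \<and> y = 0 \<and> z = 0"
        using eq \<open>e \<noteq> 0\<close> by simp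
    qed
  qed
  define sq where "sq q = fst q * cnj (fst q) + snd q * cnj (snd q)" for q :: "complex \<times> complex"
  have sq: "sq q \<noteq> 0" if "q \<noteq> 0" for q
  proof -
    have "sq q = of_real ((norm (fst q))\<^sup>2 + (norm (snd q))\<^sup>2)"
      by (simp add: sq_def complex_mult_cnj cmod_power2)
    then show ?thesis
      using that by (simp only: of_real_eq_0_iff) (auto simp: prod_eq_iff add_nonneg_eq_0_iff)
  qed
  define T where "T = (- {0} :: (complex \<times> complex) set) \<times> (UNIV :: (complex \<times> complex \<times> complex) set)"
  define f where "f = (\<lambda>p. (X (fst p) * Y (snd p) - X (snd p) * Y (fst p), (X (fst p), Y (fst p)),
      ((X (snd p) * cnj (X (fst p)) + Y (snd p) * cnj (Y (fst p))) / sq (X (fst p), Y (fst p)),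
       fst p $ k, snd p $ k)))"
  define g where "g = (\<lambda>(d, q, (t, z, z')). (mk (fst q) (snd q) z,
      mk (t * fst q - d / sq q * cnj (snd q)) (t * snd q + d / sq q * cnj (fst q)) z'))"
  have "homeomorphism {(v, w). indep3 e v w} ((- {0}) \<times> T) f g"
  proof (rule homeomorphismI)
    have nz: "(X v, Y v) \<noteq> 0" if "indep3 e v w" for v w
      using that indep by (auto simp: zero_prod_def)
    have X: "continuous_on S (\<lambda>p. X (h p))" and Y: "continuous_on S (\<lambda>p. Y (h p))"
      if "continuous_on S h" for S and h :: "(complex^'n) \<times> (complex^'n) \<Rightarrow> complex^'n"
      unfolding X_def Y_def by (intro continuous_intros that)+
    have sq_cont: "continuous_on S (\<lambda>p. sq (h p))" if "continuous_on S h"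
      for S and h :: "'b::topological_space \<Rightarrow> complex \<times> complex"
      unfolding sq_def by (intro continuous_intros that)
    have mk_cont: "continuous_on S (\<lambda>p. mk (h p) (h' p) (h'' p))"
      if "continuous_on S h" "continuous_on S h'" "continuous_on S h''"
      for S and h h' h'' :: "'b::topological_space \<Rightarrow> complex"
    proof -
      have "continuous_on S (\<lambda>p. if l = k then h'' p else if l = i then (h p + h'' p * e $ i) / e $ k
          else (h' p + h'' p * e $ j) / e $ k)" for l
        by (cases "l = k"; cases "l = i"; simp; intro continuous_intros that; simp add: k)
      then show ?thesis
        unfolding mk_def by (intro continuous_on_vec_lambda)
    qed
    have "\<forall>p\<in>{(v, w). indep3 e v w}. sq (X (fst p), Y (fst p)) \<noteq> 0"
      using nz sq by fastforce
    then show "continuous_on {(v, w). indep3 e v w} f"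
      unfolding f_def by (intro continuous_intros X Y sq_cont)
    have "\<forall>r\<in>(- {0}) \<times> T. sq (fst (snd r)) \<noteq> 0"
      using sq by (auto simp: T_def)
    then show "continuous_on ((- {0}) \<times> T) g"
      unfolding g_def case_prod_unfold by (intro continuous_intros sq_cont mk_cont)
    show "f ` {(v, w). indep3 e v w} \<subseteq> (- {0}) \<times> T"
      using nz by (auto simp: f_def T_def indep)
    show "g (f p) = p" if vw: "p \<in> {(v, w). indep3 e v w}" for p
    proof -
      obtain v w where p: "p = (v, w)" and i: "indep3 e v w"
        using vw by blast
      let ?s = "sq (X v, Y v)"
      have s: "?s \<noteq> 0" "?s = X v * cnj (X v) + Y v * cnj (Y v)"
        using sq nz[OF i] by (auto simp: sq_def)
      have "(X w * cnj (X v) + Y w * cnj (Y v)) / ?s * X v - (X v * Y w - X w * Y v) / ?s * cnj (Y v) = X w"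
        using s(1) by (simp add: divide_simps) (simp add: s(2) algebra_simps)
      moreover have "(X w * cnj (X v) + Y w * cnj (Y v)) / ?s * Y v + (X v * Y w - X w * Y v) / ?s * cnj (X v) = Y w"
        using s(1) by (simp add: divide_simps) (simp add: s(2) algebra_simps)
      ultimately show ?thesis
        by (simp add: p f_def g_def mk_eta)
    qed
    show fg: "f (g r) = r" if "r \<in> (- {0}) \<times> T" for r
    proof -
      obtain d x y t z z' where r: "r = (d, (x, y), (t, z, z'))"
        by (metis prod.collapse)
      let ?s = "sq (x, y)"
      have s: "?s \<noteq> 0" "?s = x * cnj x + y * cnj y"
        using sq that by (auto simp: r T_def sq_def)
      have "x * (t * y + d / ?s * cnj x) - (t * x - d / ?s * cnj y) * y = d"
        using s(1) by (simp add: divide_simps) (simp add: s(2) algebra_simps)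
      moreover have "((t * x - d / ?s * cnj y) * cnj x + (t * y + d / ?s * cnj x) * cnj y) / ?s = t"
        using s(1) by (simp add: divide_simps) (simp add: s(2) algebra_simps)
      ultimately show ?thesis
        by (simp add: r f_def g_def mk)
    qed
    show "g ` ((- {0}) \<times> T) \<subseteq> {(v, w). indep3 e v w}"
    proof (intro image_subsetI)
      fix r assume r: "r \<in> (- {0 :: complex}) \<times> T"
      have "fst (f (g r)) \<noteq> 0"
        using fg[OF r] r by auto
      then show "g r \<in> {(v, w). indep3 e v w}"
        by (auto simp: f_def indep)
    qed
  qed
  then have "fundamental_group {(v, w). indep3 e v w} p \<cong> fundamental_group ((- {0}) \<times> T) (f p)"
    and fp: "f p \<in> (- {0}) \<times> T"
    using p by (auto intro: fundamental_group_homeomorphic simp: homeomorphism_def)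
  note this(1)
  also have "fundamental_group ((- {0}) \<times> T) (f p) = fundamental_group ((- {0}) \<times> T) (fst (f p), snd (f p))"
    by simp
  also have "\<dots> \<cong> fundamental_group (- {0}) (fst (f p))"
  proof (rule fundamental_group_Times_simply_connected)
    show "simply_connected T"
      unfolding T_def
      by (intro simply_connected_Times simply_connected_punctured_universe convex_imp_simply_connected)
         auto
  qed (use fp in auto)
  also have "\<dots> \<cong> integer_group"
    using fp by (intro fundamental_group_punctured_plane) auto
  finally show ?thesis .
qed

section \<open>Points and lines in projective space\<close>

lemma cproj_cases:
  obtains v where "v \<noteq> 0" "P = cproj_of v"
proof -
  have P: "vec.subspace (cproj_space P)" "vec.dim (cproj_space P) = 1"
    using cproj_space[of P] by auto
  then obtain v where v: "v \<in> cproj_space P" "v \<noteq> 0"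
    using vec.dim_eq_0[of "cproj_space P"] by auto
  have "vec.span {v} = cproj_space P"
    using v P by (intro vec.subspace_dim_equal vec.span_minimal) auto
  then have "P = cproj_of v"
    by (simp add: cproj_of_def cproj_space_inverse)
  with v show ?thesis
    using that by blast
qed

lemma cproj_of_eq_iff:
  assumes "u \<noteq> 0" "v \<noteq> 0"
  shows "cproj_of u = cproj_of v \<longleftrightarrow> \<not> indep2 u v"
proof -
  have "cproj_of u = cproj_of v \<longleftrightarrow> vec.span {u} = vec.span {v}"
    using assms by (metis cproj_of_def cproj_space_cproj_of)
  also have "\<dots> \<longleftrightarrow> u \<in> vec.span {v} \<and> v \<in> vec.span {u}"
    by (simp add: vec.span_eq)
  also have "\<dots> \<longleftrightarrow> \<not> indep2 u v"
    using assms indep2_commute[of u v] by (auto simp: indep2_iff_span)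
  finally show ?thesis .
qed

lemma span_UN_cproj_space:
  assumes "0 \<notin> W"
  shows "vec.span (\<Union>Q\<in>cproj_of ` W. cproj_space Q) = vec.span W"
proof -
  have "cproj_space (cproj_of w) = vec.span {w}" if "w \<in> W" for w
    using that assms by (intro cproj_space_cproj_of) auto
  then have eq: "(\<Union>Q\<in>cproj_of ` W. cproj_space Q) = (\<Union>w\<in>W. vec.span {w})"
    by simp
  show ?thesis
    unfolding eq vec.span_eq
  proof
    show "(\<Union>w\<in>W. vec.span {w}) \<subseteq> vec.span W"
      by (intro UN_least vec.span_mono) simp
    show "W \<subseteq> vec.span (\<Union>w\<in>W. vec.span {w})"
      by (intro subsetI vec.span_base UN_I) (simp_all add: vec.span_base)
  qed
qed

lemma cproj_of_in_proj_span:
  assumes "0 \<notin> W" "v \<noteq> 0"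
  shows "cproj_of v \<in> proj_span (cproj_of ` W) \<longleftrightarrow> v \<in> vec.span W"
proof -
  have "cproj_of v \<in> proj_span (cproj_of ` W) \<longleftrightarrow> vec.span {v} \<subseteq> vec.span W"
    unfolding proj_span_def mem_Collect_eq span_UN_cproj_space[OF assms(1)]
      cproj_space_cproj_of[OF assms(2)] ..
  also have "\<dots> \<longleftrightarrow> v \<in> vec.span W"
    using vec.span_minimal[of "{v}" "vec.span W"] vec.span_base[of v "{v}"] by auto
  finally show ?thesis .
qed

lemma proj_span_cproj_of_cong:
  assumes "0 \<notin> W" "0 \<notin> W'" "vec.span W = vec.span W'"
  shows "proj_span (cproj_of ` W) = proj_span (cproj_of ` W')"
  unfolding proj_span_def span_UN_cproj_space[OF assms(1)] span_UN_cproj_space[OF assms(2)] assms(3) ..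

text \<open>
  The points of the projective span cover the linear span, except for the zero vector if
  \<open>W = {}\<close>; the dimensions agree in every case.
\<close>

lemma proj_dim_proj_span:
  assumes "0 \<notin> W"
  shows "proj_dim (proj_span (cproj_of ` W)) = int (vec.dim W) - 1"
proof -
  let ?U = "\<Union>P\<in>proj_span (cproj_of ` W). cproj_space P"
  have "?U \<subseteq> vec.span W"
    unfolding proj_span_def span_UN_cproj_space[OF assms] by blast
  moreover have "W \<subseteq> ?U"
  proof
    fix w assume w: "w \<in> W"
    then have "w \<noteq> 0"
      using assms by auto
    moreover from this have "cproj_of w \<in> proj_span (cproj_of ` W)"
      using w assms by (simp add: cproj_of_in_proj_span vec.span_base)
    ultimately show "w \<in> ?U"
      by (intro UN_I[of "cproj_of w"]) (simp_all add: cproj_space_cproj_of vec.span_base)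
  qed
  ultimately have "vec.dim ?U = vec.dim W"
    by (intro antisym vec.dim_mono) (auto intro: vec.span_base)
  then show ?thesis
    by (simp add: proj_dim_def)
qed

text \<open>
  The line through \<open>[e]\<close> and \<open>[a]\<close>. Naming lines by \<open>a\<close> alone reflects that all of them
  pass through the fixed point \<open>[e]\<close>.
\<close>

definition line :: "complex^'n \<Rightarrow> complex^'n \<Rightarrow> 'n cproj set" where
  "line e a = proj_span (cproj_of ` {e, a})"

lemma cproj_of_in_line_iff:
  assumes "e \<noteq> 0" "a \<noteq> 0" "v \<noteq> 0"
  shows "cproj_of v \<in> line e a \<longleftrightarrow> v \<in> vec.span {e, a}"
  unfolding line_def using assms by (intro cproj_of_in_proj_span) auto

lemma cproj_of_in_line_iff_dependent:
  "indep2 e a \<Longrightarrow> indep2 e b \<Longrightarrow> cproj_of a \<in> line e b \<longleftrightarrow> \<not> indep3 e a b"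
  using indep2_nonzero[of e a] indep2_nonzero[of e b] indep3_swap_right[of e a b]
  by (auto simp: cproj_of_in_line_iff indep3_iff_span)

lemma cproj_of_in_line:
  assumes "indep2 e a"
  shows "cproj_of e \<in> line e a" "cproj_of a \<in> line e a" "cproj_of (a - e) \<in> line e a"
  using indep2_nonzero[OF assms] indep2_nonzero[OF indep2_diff(1)[OF assms]]
  by (auto simp: cproj_of_in_line_iff intro: vec.span_base vec.span_diff)

lemma proj_line_eq_line:
  assumes "indep2 e a"
  shows "proj_line (cproj_of a) (cproj_of (a - e)) = line e a"
proof -
  have "e \<in> vec.span {a, a - e}"
    using vec.span_diff[of a "{a, a - e}" "a - e"] by (simp add: vec.span_base)
  then have "vec.span {a, a - e} = vec.span {e, a}"
    by (auto simp: vec.span_eq intro: vec.span_base vec.span_diff)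
  then have "proj_span (cproj_of ` {a, a - e}) = proj_span (cproj_of ` {e, a})"
    using indep2_nonzero[OF assms] indep2_nonzero[OF indep2_diff(1)[OF assms]]
    by (intro proj_span_cproj_of_cong) auto
  then show ?thesis
    by (simp add: proj_line_def line_def)
qed

lemma line_Int_line:
  assumes "indep3 e a b"
  shows "line e a \<inter> line e b = {cproj_of e}"
proof -
  have ab: "indep2 e a" "indep2 e b"
    using assms indep3_swap_right[of e a b] by (auto simp: indep3_iff_span)
  have "P = cproj_of e" if P: "P \<in> line e a" "P \<in> line e b" for P
  proof -
    obtain v where v: "v \<noteq> 0" "P = cproj_of v"
      by (rule cproj_cases)
    then have "v \<in> vec.span {e, a}" "v \<in> vec.span {e, b}"
      using P ab[THEN indep2_nonzero] by (auto simp: cproj_of_in_line_iff)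
    then obtain x y x' y' where eq: "v = x *s e + y *s a" "v = x' *s e + y' *s b"
      unfolding mem_span2 by metis
    then have "(x - x') *s e + y *s a + (- y') *s b = 0"
      by (simp add: vec_eq_iff algebra_simps)
    then have "y = 0"
      using assms unfolding indep3_def by blast
    then have "\<not> indep2 e v"
      by (simp add: eq indep2_iff_span vec.span_scale vec.span_base)
    then show ?thesis
      using v ab[THEN indep2_nonzero] by (simp add: cproj_of_eq_iff indep2_commute)
  qed
  then show ?thesis
    using cproj_of_in_line ab by auto
qed

lemma line_eq_iff:
  assumes "indep2 e a" "indep2 e b"
  shows "line e a = line e b \<longleftrightarrow> \<not> indep3 e a b"
proof
  show "line e a = line e b \<Longrightarrow> \<not> indep3 e a b"
    using cproj_of_in_line[OF assms(1)] cproj_of_in_line_iff_dependent[OF assms] by auto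
  assume "\<not> indep3 e a b"
  then have "a \<in> vec.span {e, b}" "b \<in> vec.span {e, a}"
    using assms indep3_swap_right[of e a b] by (auto simp: indep3_iff_span)
  then show "line e a = line e b"
    unfolding line_def using assms[THEN indep2_nonzero]
    by (intro proj_span_cproj_of_cong) (auto simp: vec.span_eq intro: vec.span_base)
qed

text \<open>
  Collinearity gives \<open>e = x v + y w\<close> for vectors \<open>v\<close>, \<open>w\<close> representing \<open>A\<close>, \<open>B\<close>. Neither
  coefficient vanishes, as \<open>A\<close> and \<open>B\<close> differ from \<open>[e]\<close>, so \<open>a = x v\<close> still represents \<open>A\<close>
  and \<open>a - e = - y w\<close> still represents \<open>B\<close>.
\<close>

lemma pair_normal_form:
  assumes "A \<noteq> cproj_of e" "B \<noteq> cproj_of e" "cproj_of e \<in> proj_line A B" and e: "e \<noteq> 0"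
  obtains a where "indep2 e a" "A = cproj_of a" "B = cproj_of (a - e)"
proof -
  obtain v w where v: "v \<noteq> 0" "A = cproj_of v" and w: "w \<noteq> 0" "B = cproj_of w"
    by (metis cproj_cases)
  have iv: "indep2 e v" and iw: "indep2 e w"
    using assms v w cproj_of_eq_iff[of v e] cproj_of_eq_iff[of w e] indep2_commute by auto
  have "e \<in> vec.span {v, w}"
    using assms v w cproj_of_in_proj_span[of "{v, w}" e] by (auto simp: proj_line_def)
  then obtain x y where eq: "e = x *s v + y *s w"
    by (auto simp: mem_span2)
  have "x \<noteq> 0"
  proof
    assume "x = 0"
    then have "1 *s e + (- y) *s w = 0"
      using eq by simp
    then show False
      using iw unfolding indep2_def by (metis one_neq_zero)
  qed
  have "y \<noteq> 0"
  proof
    assume "y = 0"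
    then have "1 *s e + (- x) *s v = 0"
      using eq by simp
    then show False
      using iv unfolding indep2_def by (metis one_neq_zero)
  qed
  have scale: "cproj_of u = cproj_of (c *s u)" if "u \<noteq> 0" "c \<noteq> 0" for u :: "complex^'a" and c
    using that by (simp add: cproj_of_eq_iff indep2_iff_span vec.span_singleton)
  show ?thesis
  proof (rule that[of "x *s v"])
    show "indep2 e (x *s v)"
      unfolding indep2_def
    proof (intro allI impI)
      fix s t assume "s *s e + t *s (x *s v) = 0"
      then have "s *s e + (t * x) *s v = 0"
        by simp
      then have "s = 0 \<and> t * x = 0"
        using iv unfolding indep2_def by blast
      then show "s = 0 \<and> t = 0"
        using \<open>x \<noteq> 0\<close> by simp
    qed
    show "A = cproj_of (x *s v)"
      unfolding v(2) by (rule scale[OF v(1) \<open>x \<noteq> 0\<close>])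
    have "x *s v - e = (- y) *s w"
      by (subst eq) simp
    then show "B = cproj_of (x *s v - e)"
      using scale[OF w(1), of "- y"] w(2) \<open>y \<noteq> 0\<close> by (metis neg_equal_0_iff_equal)
  qed
qed

section \<open>The quotient topology of projective space\<close>

lemma open_cproj_iff: "open U \<longleftrightarrow> open {v :: complex^'n. v \<noteq> 0 \<and> cproj_of v \<in> U}"
  unfolding open_cproj_def openin_open_eq[OF open_Compl[OF closed_singleton]] by blast

lemma continuous_on_cproj_of: "continuous_on (- {0}) (cproj_of :: complex^'n \<Rightarrow> 'n cproj)"
proof -
  have "open ((cproj_of :: complex^'n \<Rightarrow> 'n cproj) -` U \<inter> - {0})" if "open U" for U
  proof -
    have "(cproj_of :: complex^'n \<Rightarrow> 'n cproj) -` U \<inter> - {0} = {v. v \<noteq> 0 \<and> cproj_of v \<in> U}"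
      by auto
    then show ?thesis
      using that open_cproj_iff[of U] by simp
  qed
  then show ?thesis
    by (subst continuous_on_open_vimage) auto
qed

text \<open>
  The saturation of an open set is the union of its multiples by nonzero scalars.
\<close>

lemma open_map_cproj_of:
  assumes S: "open S" "0 \<notin> S"
  shows "open (cproj_of ` (S :: (complex^'n) set))"
proof -
  have eq: "{v. v \<noteq> 0 \<and> cproj_of v \<in> cproj_of ` S} = (\<Union>c\<in>-{0}. (\<lambda>v. c *s v) -` S)"
  proof (intro equalityI subsetI)
    fix v assume "v \<in> {v. v \<noteq> 0 \<and> cproj_of v \<in> cproj_of ` S}"
    then obtain s where v: "v \<noteq> 0" and s: "s \<in> S" "cproj_of v = cproj_of s"
      by auto
    then have "s \<noteq> 0"
      using S by auto
    then have "s \<in> vec.span {v}"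
      using v s by (simp add: cproj_of_eq_iff indep2_iff_span)
    then obtain c where c: "s = c *s v"
      by (auto simp: vec.span_singleton)
    with \<open>s \<noteq> 0\<close> have "c \<noteq> 0"
      by auto
    then show "v \<in> (\<Union>c\<in>-{0}. (\<lambda>v. c *s v) -` S)"
      using c s by auto
  next
    fix v assume "v \<in> (\<Union>c\<in>-{0}. (\<lambda>v. c *s v) -` S)"
    then obtain c where c: "c \<noteq> 0" "c *s v \<in> S"
      by auto
    then have v: "v \<noteq> 0"
      using S by auto
    then have "cproj_of v = cproj_of (c *s v)"
      using c by (simp add: cproj_of_eq_iff indep2_iff_span vec.span_scale vec.span_base)
    then show "v \<in> {v. v \<noteq> 0 \<and> cproj_of v \<in> cproj_of ` S}"
      using c v by auto
  qed
  have "open ((\<lambda>v. c *s v) -` S)" for c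
    by (rule open_vimage[OF S(1)]) (intro continuous_intros)
  then show ?thesis
    unfolding open_cproj_iff eq by (intro open_UN) auto
qed

text \<open>
  A product of two quotient maps need not be a quotient map, but \<open>cproj_of\<close> is open on the
  nonzero vectors, and openness passes to products and to restrictions to the preimage of an
  arbitrary set \<open>S\<close>.
\<close>

lemma continuous_on_cproj_pairs:
  fixes f :: "'n::finite cproj \<times> 'n cproj \<Rightarrow> 'b::topological_space"
  assumes cont: "continuous_on {(v, w). v \<noteq> 0 \<and> w \<noteq> 0 \<and> (cproj_of v, cproj_of w) \<in> S}
      (\<lambda>(v, w). f (cproj_of v, cproj_of w))" (is "continuous_on ?T ?g")
  shows "continuous_on S f"
  unfolding continuous_on_open_invariant
proof (intro allI impI)
  fix B :: "'b set" assume "open B"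
  then obtain O' where O': "open O'" "O' \<inter> ?T = ?g -` B \<inter> ?T"
    using cont unfolding continuous_on_open_invariant by blast
  define Q where "Q = O' \<inter> (- {0}) \<times> (- {0})"
  have Q: "open Q" "Q \<subseteq> (- {0}) \<times> (- {0})"
    unfolding Q_def using O'(1) by (auto intro!: open_Int open_Times)
  have "open (map_prod cproj_of cproj_of ` Q)"
    unfolding open_prod_def
  proof (intro ballI)
    fix x assume "x \<in> map_prod cproj_of cproj_of ` Q"
    then obtain v w where vw: "(v, w) \<in> Q" "x = (cproj_of v, cproj_of w)"
      by auto
    then obtain V W where VW: "open V" "open W" "v \<in> V" "w \<in> W" "V \<times> W \<subseteq> Q"
      using Q(1) by (metis open_prod_elim mem_Sigma_iff)
    then have "0 \<notin> V" "0 \<notin> W"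
      using Q(2) by auto
    then have "open (cproj_of ` V)" "open (cproj_of ` W)"
      using VW by (auto intro: open_map_cproj_of)
    moreover have "cproj_of ` V \<times> cproj_of ` W \<subseteq> map_prod cproj_of cproj_of ` Q"
      using VW(5) by (auto simp flip: map_prod_surj_on)
    ultimately show "\<exists>A B. open A \<and> open B \<and> x \<in> A \<times> B \<and> A \<times> B \<subseteq> map_prod cproj_of cproj_of ` Q"
      using VW vw by blast
  qed
  moreover have "map_prod cproj_of cproj_of ` Q \<inter> S = f -` B \<inter> S"
  proof (intro equalityI subsetI)
    fix x assume "x \<in> map_prod cproj_of cproj_of ` Q \<inter> S"
    then obtain v w where vw: "(v, w) \<in> Q" "x = (cproj_of v, cproj_of w)" "x \<in> S"
      by auto
    then have "(v, w) \<in> O' \<inter> ?T"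
      by (auto simp: Q_def)
    then show "x \<in> f -` B \<inter> S"
      using O'(2) vw by auto
  next
    fix x assume x: "x \<in> f -` B \<inter> S"
    obtain v w where vw: "v \<noteq> 0" "w \<noteq> 0" "x = (cproj_of v, cproj_of w)"
      by (metis cproj_cases prod.collapse)
    then have "(v, w) \<in> ?g -` B \<inter> ?T"
      using x by auto
    then have "(v, w) \<in> O'"
      using O'(2) by blast
    then have "(v, w) \<in> Q"
      using vw(1,2) by (simp add: Q_def)
    then show "x \<in> map_prod cproj_of cproj_of ` Q \<inter> S"
      using x vw(3) by (intro IntI image_eqI[of _ _ "(v, w)"]) auto
  qed
  ultimately show "\<exists>A. open A \<and> A \<inter> S = f -` B \<inter> S"
    by blast
qed

section \<open>Desargues configurations in coordinates\<close>

text \<open>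
  The differences of the vectors recover \<open>e\<close>, so the six vectors span the same space as \<open>e\<close>,
  \<open>a1\<close>, \<open>a2\<close>, \<open>a3\<close>.
\<close>

lemma dim_desargues:
  assumes i: "indep3 e a1 a2"
  shows "vec.dim {a1, a1 - e, a2, a2 - e, a3, a3 - e} = 3 \<longleftrightarrow> a3 \<in> vec.span {e, a1, a2}"
proof -
  let ?W = "{a1, a1 - e, a2, a2 - e, a3, a3 - e}"
  have "a1 - (a1 - e) \<in> vec.span ?W"
    by (intro vec.span_diff vec.span_base) auto
  then have "e \<in> vec.span ?W"
    by simp
  then have "vec.span ?W = vec.span {a3, e, a1, a2}"
    unfolding vec.span_eq by (auto intro: vec.span_base vec.span_diff)
  then have "vec.dim ?W = vec.dim {a3, e, a1, a2}"
    by (rule vec.span_eq_dim)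
  then show ?thesis
    by (simp add: vec.dim_insert[of a3] dim_indep3[OF i])
qed

lemma planar_desargues_at_unfold:
  fixes A1 B1 A2 B2 A3 B3 I :: "'n::finite cproj"
  defines "d1 \<equiv> proj_line A1 B1" and "d2 \<equiv> proj_line A2 B2" and "d3 \<equiv> proj_line A3 B3"
  shows "(A1, B1, A2, B2, A3, B3) \<in> planar_desargues_at I \<longleftrightarrow>
    distinct [A1, B1, A2, B2, A3, B3] \<and> proj_dim (proj_span {A1, B1, A2, B2, A3, B3}) = 2 \<and>
    distinct [d1, d2, d3] \<and> d1 \<inter> d2 \<inter> d3 = {I} \<and>
    {A1, B1} \<subseteq> d1 - {I} \<and> {A2, B2} \<subseteq> d2 - {I} \<and> {A3, B3} \<subseteq> d3 - {I}"
proof -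
  have ex: "\<exists>J. {I} = {J}"
    by blast
  have "(A1, B1, A2, B2, A3, B3) \<in> planar_desargues_at I \<longleftrightarrow>
      (A1, B1, A2, B2, A3, B3) \<in> planar_desargues \<and> d1 \<inter> d2 \<inter> d3 = {I}"
    unfolding planar_desargues_at_def d1_def d2_def d3_def by simp
  also have "\<dots> \<longleftrightarrow>
    distinct [A1, B1, A2, B2, A3, B3] \<and> proj_dim (proj_span {A1, B1, A2, B2, A3, B3}) = 2 \<and>
    distinct [d1, d2, d3] \<and> d1 \<inter> d2 \<inter> d3 = {I} \<and>
    {A1, B1} \<subseteq> d1 - {I} \<and> {A2, B2} \<subseteq> d2 - {I} \<and> {A3, B3} \<subseteq> d3 - {I}"
    unfolding planar_desargues_def Let_def mem_Collect_eq prod.case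
    unfolding d1_def[symmetric] d2_def[symmetric] d3_def[symmetric]
    by (cases "d1 \<inter> d2 \<inter> d3 = {I}") (simp_all only: ex simp_thms)
  finally show ?thesis .
qed

text \<open>
  In terms of the normal forms \<open>(a, a - e)\<close>, two of the lines differ if and only if their
  vectors are independent together with \<open>e\<close>; this also makes the six points distinct and the
  lines concurrent exactly in \<open>[e]\<close>. Planarity is the condition on \<open>a3\<close>.
\<close>

lemma planar_desargues_at_iff:
  assumes e: "e \<noteq> 0"
  shows "(A1, B1, A2, B2, A3, B3) \<in> planar_desargues_at (cproj_of e) \<longleftrightarrow>
    (\<exists>a1 a2 a3. indep3 e a1 a2 \<and> indep3 e a1 a3 \<and> indep3 e a2 a3 \<and> a3 \<in> vec.span {e, a1, a2} \<and>
       A1 = cproj_of a1 \<and> B1 = cproj_of (a1 - e) \<and> A2 = cproj_of a2 \<and> B2 = cproj_of (a2 - e) \<and>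
       A3 = cproj_of a3 \<and> B3 = cproj_of (a3 - e))"
    (is "?L \<longleftrightarrow> ?R")
proof
  assume ?L
  then have lines: "distinct [proj_line A1 B1, proj_line A2 B2, proj_line A3 B3]"
    and dim: "proj_dim (proj_span {A1, B1, A2, B2, A3, B3}) = 2"
    and I: "proj_line A1 B1 \<inter> proj_line A2 B2 \<inter> proj_line A3 B3 = {cproj_of e}"
    and off: "A1 \<noteq> cproj_of e" "B1 \<noteq> cproj_of e" "A2 \<noteq> cproj_of e" "B2 \<noteq> cproj_of e"
      "A3 \<noteq> cproj_of e" "B3 \<noteq> cproj_of e"
    unfolding planar_desargues_at_unfold by (simp_all only:) auto
  have on: "cproj_of e \<in> proj_line A1 B1" "cproj_of e \<in> proj_line A2 B2" "cproj_of e \<in> proj_line A3 B3"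
    using I by auto
  obtain a1 where a1: "indep2 e a1" "A1 = cproj_of a1" "B1 = cproj_of (a1 - e)"
    using pair_normal_form[OF off(1,2) on(1) e] .
  obtain a2 where a2: "indep2 e a2" "A2 = cproj_of a2" "B2 = cproj_of (a2 - e)"
    using pair_normal_form[OF off(3,4) on(2) e] .
  obtain a3 where a3: "indep2 e a3" "A3 = cproj_of a3" "B3 = cproj_of (a3 - e)"
    using pair_normal_form[OF off(5,6) on(3) e] .
  have i: "indep3 e a1 a2" "indep3 e a1 a3" "indep3 e a2 a3"
    using lines a1 a2 a3 by (simp_all add: proj_line_eq_line line_eq_iff)
  let ?W = "{a1, a1 - e, a2, a2 - e, a3, a3 - e}"
  have "0 \<notin> ?W"
    using indep2_nonzero_diff[OF a1(1)] indep2_nonzero_diff[OF a2(1)] indep2_nonzero_diff[OF a3(1)]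
    by auto
  moreover have "{A1, B1, A2, B2, A3, B3} = cproj_of ` ?W"
    using a1 a2 a3 by simp
  ultimately have "int (vec.dim ?W) - 1 = 2"
    using dim proj_dim_proj_span[of ?W] by metis
  then have "vec.dim ?W = 3"
    by linarith
  then have "a3 \<in> vec.span {e, a1, a2}"
    using dim_desargues[OF i(1)] by blast
  then show ?R
    using i a1 a2 a3 by blast
next
  assume ?R
  then obtain a1 a2 a3 where i: "indep3 e a1 a2" "indep3 e a1 a3" "indep3 e a2 a3"
    and sp: "a3 \<in> vec.span {e, a1, a2}"
    and P: "A1 = cproj_of a1" "B1 = cproj_of (a1 - e)" "A2 = cproj_of a2" "B2 = cproj_of (a2 - e)"
       "A3 = cproj_of a3" "B3 = cproj_of (a3 - e)"
    by blast
  have i2: "indep2 e a1" "indep2 e a2" "indep2 e a3"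
    using i indep3_swap_right[of e a1 a2] indep3_swap_right[of e a1 a3] by (auto simp: indep3_iff_span)
  note nz = indep2_nonzero_diff
  have off: "cproj_of a \<noteq> cproj_of e" "cproj_of (a - e) \<noteq> cproj_of e" "cproj_of a \<noteq> cproj_of (a - e)"
    if "indep2 e a" for a
    using that e nz[OF that] indep2_diff[OF that] by (auto simp: cproj_of_eq_iff indep2_commute[of _ e])
  have in_line: "cproj_of a \<in> line e a" "cproj_of (a - e) \<in> line e a" "cproj_of e \<in> line e a"
    if "indep2 e a" for a
    using cproj_of_in_line[OF that] by auto
  have sep: "{cproj_of a, cproj_of (a - e)} \<inter> {cproj_of b, cproj_of (b - e)} = {}"
    if ab: "indep3 e a b" "indep2 e a" "indep2 e b" for a b
  proof -
    have "{cproj_of a, cproj_of (a - e)} \<subseteq> line e a - {cproj_of e}"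
      "{cproj_of b, cproj_of (b - e)} \<subseteq> line e b"
      using in_line[OF ab(2)] in_line[OF ab(3)] off[OF ab(2)] by simp_all
    then show ?thesis
      using line_Int_line[OF ab(1)] by blast
  qed
  let ?W = "{a1, a1 - e, a2, a2 - e, a3, a3 - e}"
  have "0 \<notin> ?W"
    using i2 nz by auto
  then have "proj_dim (proj_span (cproj_of ` ?W)) = int (vec.dim ?W) - 1"
    by (rule proj_dim_proj_span)
  moreover have "cproj_of ` ?W = {A1, B1, A2, B2, A3, B3}"
    by (simp add: P)
  moreover have "vec.dim ?W = 3"
    using dim_desargues[OF i(1)] sp by blast
  ultimately have dim: "proj_dim (proj_span {A1, B1, A2, B2, A3, B3}) = 2"
    by simp
  have lines: "proj_line A1 B1 = line e a1" "proj_line A2 B2 = line e a2" "proj_line A3 B3 = line e a3"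
    unfolding P using i2 by (simp_all only: proj_line_eq_line)
  have ne: "line e a1 \<noteq> line e a2" "line e a1 \<noteq> line e a3" "line e a2 \<noteq> line e a3"
    using i i2 by (simp_all add: line_eq_iff)
  have Int: "line e a1 \<inter> line e a2 \<inter> line e a3 = {cproj_of e}"
    using line_Int_line[OF i(1)] in_line(3)[OF i2(3)] by auto
  have "distinct [A1, B1, A2, B2, A3, B3]"
    using sep[OF i(1) i2(1,2)] sep[OF i(2) i2(1,3)] sep[OF i(3) i2(2,3)]
      off(3)[OF i2(1)] off(3)[OF i2(2)] off(3)[OF i2(3)]
    unfolding P by auto
  then show ?L
    using dim ne Int in_line[OF i2(1)] in_line[OF i2(2)] in_line[OF i2(3)]
      off[OF i2(1)] off[OF i2(2)] off[OF i2(3)]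
    unfolding planar_desargues_at_unfold lines by (simp add: P)
qed

text \<open>
  The parameters \<open>(\<alpha>, \<beta>, (a1, a2), \<gamma>)\<close> of a configuration. The coordinates \<open>\<alpha>\<close> and \<open>\<beta>\<close>,
  which range over punctured planes, come first, to be split off one by one.
\<close>

type_synonym 'n desargues_param =
  "complex \<times> complex \<times> ((complex, 'n) vec \<times> (complex, 'n) vec) \<times> complex"

definition desargues_params :: "complex^'n \<Rightarrow> 'n desargues_param set" where
  "desargues_params e = (- {0}) \<times> (- {0}) \<times> {(v, w). indep3 e v w} \<times> UNIV"

definition third_vector :: "complex^'n \<Rightarrow> 'n desargues_param \<Rightarrow> complex^'n" where
  "third_vector e = (\<lambda>(\<alpha>, \<beta>, (a1, a2), \<gamma>). \<gamma> *s e + \<alpha> *s a1 + \<beta> *s a2)"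

definition desargues_of_params :: "complex^'n \<Rightarrow> 'n desargues_param \<Rightarrow> 'n six_points" where
  "desargues_of_params e y =
    (let a1 = fst (fst (snd (snd y))); a2 = snd (fst (snd (snd y))); a3 = third_vector e y in
     (cproj_of a1, cproj_of (a1 - e), cproj_of a2, cproj_of (a2 - e), cproj_of a3, cproj_of (a3 - e)))"

lemma params_third_vector:
  assumes "y \<in> desargues_params e"
  shows "indep3 e (fst (fst (snd (snd y)))) (third_vector e y)"
    "indep3 e (snd (fst (snd (snd y)))) (third_vector e y)"
    "third_vector e y \<in> vec.span {e, fst (fst (snd (snd y))), snd (fst (snd (snd y)))}"
proof -
  obtain \<alpha> \<beta> a1 a2 \<gamma> where y: "y = (\<alpha>, \<beta>, (a1, a2), \<gamma>)"
    by (metis prod.collapse)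
  have nz: "\<alpha> \<noteq> 0" "\<beta> \<noteq> 0" and i: "indep3 e a1 a2"
    using assms by (auto simp: y desargues_params_def)
  have i0: "x = 0 \<and> y = 0 \<and> z = 0" if "x *s e + y *s a1 + z *s a2 = 0" for x y z
    using i that unfolding indep3_def by blast
  show "indep3 e (fst (fst (snd (snd y)))) (third_vector e y)"
    unfolding indep3_def
  proof (intro allI impI)
    fix p q r assume "p *s e + q *s fst (fst (snd (snd y))) + r *s third_vector e y = 0"
    then have "(p + r * \<gamma>) *s e + (q + r * \<alpha>) *s a1 + (r * \<beta>) *s a2 = 0"
      by (simp add: y third_vector_def vec_eq_iff algebra_simps)
    from i0[OF this] show "p = 0 \<and> q = 0 \<and> r = 0"
      using nz by auto
  qed
  show "indep3 e (snd (fst (snd (snd y)))) (third_vector e y)"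
    unfolding indep3_def
  proof (intro allI impI)
    fix p q r assume "p *s e + q *s snd (fst (snd (snd y))) + r *s third_vector e y = 0"
    then have "(p + r * \<gamma>) *s e + (r * \<alpha>) *s a1 + (q + r * \<beta>) *s a2 = 0"
      by (simp add: y third_vector_def vec_eq_iff algebra_simps)
    from i0[OF this] show "p = 0 \<and> q = 0 \<and> r = 0"
      using nz by auto
  qed
  show "third_vector e y \<in> vec.span {e, fst (fst (snd (snd y))), snd (fst (snd (snd y)))}"
    unfolding mem_span3 by (auto simp: y third_vector_def)
qed

lemma desargues_of_params_image:
  assumes e: "e \<noteq> 0"
  shows "desargues_of_params e ` desargues_params e = planar_desargues_at (cproj_of e)"
proof (intro equalityI subsetI)
  fix x assume "x \<in> desargues_of_params e ` desargues_params e"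
  then obtain y where y: "y \<in> desargues_params e" "x = desargues_of_params e y"
    by blast
  have "indep3 e (fst (fst (snd (snd y)))) (snd (fst (snd (snd y))))"
    using y(1) by (auto simp: desargues_params_def)
  then show "x \<in> planar_desargues_at (cproj_of e)"
    unfolding y(2) desargues_of_params_def Let_def planar_desargues_at_iff[OF e]
    using params_third_vector[OF y(1)] by blast
next
  fix x assume x: "x \<in> planar_desargues_at (cproj_of e)"
  obtain A1 B1 A2 B2 A3 B3 where x_eq: "x = (A1, B1, A2, B2, A3, B3)"
    by (metis prod.collapse)
  obtain a1 a2 a3 where i: "indep3 e a1 a2" "indep3 e a1 a3" "indep3 e a2 a3"
    and sp: "a3 \<in> vec.span {e, a1, a2}"
    and P: "A1 = cproj_of a1" "B1 = cproj_of (a1 - e)" "A2 = cproj_of a2" "B2 = cproj_of (a2 - e)"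
       "A3 = cproj_of a3" "B3 = cproj_of (a3 - e)"
    using x unfolding x_eq planar_desargues_at_iff[OF e] by blast
  obtain \<gamma> \<alpha> \<beta> where a3: "a3 = \<gamma> *s e + \<alpha> *s a1 + \<beta> *s a2"
    using sp by (auto simp: mem_span3)
  have "\<beta> \<noteq> 0"
  proof
    assume "\<beta> = 0"
    then have "a3 \<in> vec.span {e, a1}"
      by (auto simp: a3 mem_span2)
    then show False
      using i(2) by (simp add: indep3_iff_span)
  qed
  moreover have "\<alpha> \<noteq> 0"
  proof
    assume "\<alpha> = 0"
    then have "a3 \<in> vec.span {e, a2}"
      by (auto simp: a3 mem_span2)
    then show False
      using i(3) by (simp add: indep3_iff_span)
  qed
  ultimately have "(\<alpha>, \<beta>, (a1, a2), \<gamma>) \<in> desargues_params e"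
    using i(1) by (simp add: desargues_params_def)
  moreover have "x = desargues_of_params e (\<alpha>, \<beta>, (a1, a2), \<gamma>)"
    by (simp add: x_eq P desargues_of_params_def Let_def third_vector_def a3)
  ultimately show "x \<in> desargues_of_params e ` desargues_params e"
    by blast
qed

text \<open>
  Meaningful for the pairs of points that have a normal form, for which \<open>a\<close> is unique.
\<close>

definition lift_pair :: "complex^'n \<Rightarrow> 'n cproj \<times> 'n cproj \<Rightarrow> complex^'n" where
  "lift_pair e PQ = (THE a. indep2 e a \<and> PQ = (cproj_of a, cproj_of (a - e)))"

text \<open>
  From \<open>a = c v\<close> and \<open>a - e = d w\<close> follows \<open>e = c v - d w\<close>: the factor by which to scale \<open>v\<close> is
  its coefficient in \<open>e\<close>, which is continuous in \<open>v\<close> and \<open>w\<close>. In particular \<open>a\<close> is unique.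
\<close>

lemma lift_pair_eq:
  assumes v: "indep2 e a" "v \<noteq> 0" "w \<noteq> 0" "cproj_of v = cproj_of a" "cproj_of w = cproj_of (a - e)"
  shows "coef2 w v e *s v = a" "indep2 w v"
proof -
  note a = indep2_nonzero_diff[OF v(1)]
  have "a \<in> vec.span {v}" "a - e \<in> vec.span {w}"
    using v a by (auto simp: cproj_of_eq_iff indep2_iff_span)
  then obtain c d where c: "a = c *s v" and d: "a - e = d *s w"
    by (auto simp: vec.span_singleton)
  have cd: "c \<noteq> 0" "d \<noteq> 0"
    using a c d by auto
  show wv: "indep2 w v"
    unfolding indep2_def
  proof (intro allI impI)
    fix x y assume "x *s w + y *s v = 0"
    then have "(x / d) *s (d *s w) + (y / c) *s (c *s v) = 0"
      using cd by simp
    then have "(y / c) *s a + (x / d) *s (a - e) = 0"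
      unfolding d unfolding c by (simp only: add.commute)
    then have "y / c = 0 \<and> x / d = 0"
      using indep2_diff(2)[OF v(1)] unfolding indep2_def by blast
    then show "x = 0 \<and> y = 0"
      using cd by simp
  qed
  have "e = (- d) *s w + c *s v"
    using c d by (metis add.commute diff_add_cancel diff_diff_eq2 minus_diff_eq uminus_add_conv_diff vec.scale_minus_left)
  then show "coef2 w v e *s v = a"
    using coef2_eq[OF wv] c by metis
qed

lemma lift_pair:
  assumes "indep2 e a"
  shows "lift_pair e (cproj_of a, cproj_of (a - e)) = a"
  unfolding lift_pair_def
proof (rule the_equality)
  fix b assume b: "indep2 e b \<and> (cproj_of a, cproj_of (a - e)) = (cproj_of b, cproj_of (b - e))"
  note a = indep2_nonzero_diff[OF assms]
  show "b = a"
    using lift_pair_eq(1)[OF assms a] lift_pair_eq(1)[of e b a "a - e"] a b by auto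
qed (use assms in auto)

lemma continuous_on_lift_pair:
  "continuous_on {(cproj_of a, cproj_of (a - e)) | a. indep2 e a} (lift_pair e)"
proof (rule continuous_on_cproj_pairs)
  let ?T = "{(v, w). v \<noteq> 0 \<and> w \<noteq> 0 \<and>
     (cproj_of v, cproj_of w) \<in> {(cproj_of a, cproj_of (a - e)) | a. indep2 e a}}"
  have T: "indep2 (snd p) (fst p)"
    "coef2 (snd p) (fst p) e *s fst p = (case p of (v, w) \<Rightarrow> lift_pair e (cproj_of v, cproj_of w))"
    if "p \<in> ?T" for p
  proof -
    obtain v w a where p: "p = (v, w)" and a: "indep2 e a" "v \<noteq> 0" "w \<noteq> 0"
        "cproj_of v = cproj_of a" "cproj_of w = cproj_of (a - e)"
      using \<open>p \<in> ?T\<close> by auto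
    show "indep2 (snd p) (fst p)"
      using lift_pair_eq(2)[OF a] by (simp add: p)
    show "coef2 (snd p) (fst p) e *s fst p = (case p of (v, w) \<Rightarrow> lift_pair e (cproj_of v, cproj_of w))"
      using lift_pair_eq(1)[OF a] lift_pair[OF a(1)] by (simp add: p a(4,5))
  qed
  have "continuous_on ?T (\<lambda>p. coef2 (snd p) (fst p) e *s fst p)"
    by (intro continuous_intros continuous_on_coef2 T)
  then show "continuous_on ?T (\<lambda>(v, w). lift_pair e (cproj_of v, cproj_of w))"
    by (rule continuous_on_eq) (use T in auto)
qed

text \<open>
  The three bases consist of the same vectors, ordered so that the one whose coefficient is
  wanted comes last.
\<close>

definition params_of_desargues :: "complex^'n \<Rightarrow> 'n six_points \<Rightarrow> 'n desargues_param" where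
  "params_of_desargues e x = (let a1 = lift_pair e (fst x, fst (snd x));
      a2 = lift_pair e (fst (snd (snd x)), fst (snd (snd (snd x))));
      a3 = lift_pair e (snd (snd (snd (snd x))))
    in (coef3 e a2 a1 a3, coef3 e a1 a2 a3, (a1, a2), coef3 a1 a2 e a3))"

lemma params_independent:
  assumes "y \<in> desargues_params e"
  shows "indep2 e (fst (fst (snd (snd y))))" "indep2 e (snd (fst (snd (snd y))))" "indep2 e (third_vector e y)"
    "indep3 e (fst (fst (snd (snd y)))) (snd (fst (snd (snd y))))"
proof -
  show i: "indep3 e (fst (fst (snd (snd y)))) (snd (fst (snd (snd y))))"
    using assms by (auto simp: desargues_params_def)
  then show "indep2 e (fst (fst (snd (snd y))))" "indep2 e (snd (fst (snd (snd y))))" "indep2 e (third_vector e y)"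
    using params_third_vector(1)[OF assms] i indep3_swap_right by (auto simp: indep3_iff_span)
qed

text \<open>
  The vectors are recovered by \<open>lift_pair\<close>, and the scalars as coordinates of the third vector
  with respect to \<open>e\<close> and the first two; both depend continuously on the configuration.
\<close>

lemma homeomorphism_desargues_of_params:
  assumes e: "e \<noteq> 0"
  shows "homeomorphism (desargues_params e) (planar_desargues_at (cproj_of e))
    (desargues_of_params e) (params_of_desargues e)"
proof -
  have uc: "params_of_desargues e (desargues_of_params e y) = y" if y: "y \<in> desargues_params e" for y
  proof -
    obtain \<alpha> \<beta> a1 a2 \<gamma> where y_eq: "y = (\<alpha>, \<beta>, (a1, a2), \<gamma>)"
      by (metis prod.collapse)
    have i: "indep3 e a1 a2" "indep3 e a2 a1" "indep3 a1 a2 e"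
      using params_independent(4)[OF y] indep3_swap_right[of e a1 a2] indep3_swap_left[of e a1 a2]
        indep3_swap_right[of a1 e a2]
      by (simp_all add: y_eq)
    have lift: "lift_pair e (cproj_of a1, cproj_of (a1 - e)) = a1"
      "lift_pair e (cproj_of a2, cproj_of (a2 - e)) = a2"
      "lift_pair e (cproj_of (third_vector e y), cproj_of (third_vector e y - e)) = third_vector e y"
      using params_independent[OF y] by (auto simp: y_eq intro: lift_pair)
    have perm: "third_vector e y = \<gamma> *s e + \<alpha> *s a1 + \<beta> *s a2"
      "third_vector e y = \<gamma> *s e + \<beta> *s a2 + \<alpha> *s a1"
      "third_vector e y = \<alpha> *s a1 + \<beta> *s a2 + \<gamma> *s e"
      by (simp_all add: third_vector_def y_eq add_ac)
    have "coef3 e a1 a2 (third_vector e y) = \<beta>" "coef3 e a2 a1 (third_vector e y) = \<alpha>"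
      "coef3 a1 a2 e (third_vector e y) = \<gamma>"
      using coef3_eq[OF i(1)] coef3_eq[OF i(2)] coef3_eq[OF i(3)] perm by metis+
    then show ?thesis
      using lift unfolding params_of_desargues_def desargues_of_params_def Let_def by (simp add: y_eq)
  qed
  have D: "planar_desargues_at (cproj_of e) = desargues_of_params e ` desargues_params e"
    using desargues_of_params_image[OF e] ..
  show ?thesis
  proof (rule homeomorphismI)
    have third: "continuous_on (desargues_params e) (third_vector e)"
      unfolding third_vector_def case_prod_unfold by (intro continuous_intros)
    have c: "continuous_on (desargues_params e) (\<lambda>y. cproj_of (h y))"
      if "continuous_on (desargues_params e) h" "\<And>y. y \<in> desargues_params e \<Longrightarrow> h y \<noteq> 0" for h
      using that by (intro continuous_on_compose2[OF continuous_on_cproj_of]) auto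
    have nonzero: "fst (fst (snd (snd y))) \<noteq> 0" "fst (fst (snd (snd y))) - e \<noteq> 0"
        "snd (fst (snd (snd y))) \<noteq> 0" "snd (fst (snd (snd y))) - e \<noteq> 0"
        "third_vector e y \<noteq> 0" "third_vector e y - e \<noteq> 0" if "y \<in> desargues_params e" for y
      using indep2_nonzero_diff[OF params_independent(1)[OF that]]
        indep2_nonzero_diff[OF params_independent(2)[OF that]]
        indep2_nonzero_diff[OF params_independent(3)[OF that]] by simp_all
    show "continuous_on (desargues_params e) (desargues_of_params e)"
      unfolding desargues_of_params_def Let_def
      by (intro continuous_on_Pair c continuous_intros third nonzero)
    show "continuous_on (planar_desargues_at (cproj_of e)) (params_of_desargues e)"
    proof -
      let ?D = "planar_desargues_at (cproj_of e)"
      let ?a1 = "\<lambda>x. lift_pair e (fst x, fst (snd x))"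
        and ?a2 = "\<lambda>x. lift_pair e (fst (snd (snd x)), fst (snd (snd (snd x))))"
        and ?a3 = "\<lambda>x. lift_pair e (snd (snd (snd (snd x))))"
      define P where "P = {(cproj_of a, cproj_of (a - e)) | a. indep2 e a}"
      have P: "(cproj_of a, cproj_of (a - e)) \<in> P" if "indep2 e a" for a
        using that by (auto simp: P_def)
      have a: "continuous_on ?D ?a1" "continuous_on ?D ?a2" "continuous_on ?D ?a3"
        by (rule continuous_on_compose2[OF continuous_on_lift_pair[of e, folded P_def]],
            intro continuous_intros,
            simp add: D image_subset_iff desargues_of_params_def Let_def P params_independent)+
      have i: "indep3 e (?a1 x) (?a2 x)" if x: "x \<in> ?D" for x
      proof -
        obtain y where "y \<in> desargues_params e" "x = desargues_of_params e y"
          using x unfolding D by blast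
        then show ?thesis
          by (simp add: desargues_of_params_def Let_def lift_pair params_independent)
      qed
      then have "indep3 e (?a2 x) (?a1 x)" "indep3 (?a1 x) (?a2 x) e" if "x \<in> ?D" for x
        using that indep3_swap_right[of e "?a1 x" "?a2 x"] indep3_swap_left[of e "?a1 x" "?a2 x"]
          indep3_swap_right[of "?a1 x" e "?a2 x"]
        by simp_all
      then show ?thesis
        unfolding params_of_desargues_def Let_def
        using a i by (intro continuous_on_Pair continuous_on_coef3 continuous_on_const)
    qed
  qed (use uc D in auto)
qed

theorem theorem1p2:
  fixes n :: nat and I :: "'n::finite cproj" and x :: "'n six_points"
  assumes "CARD('n) = n + 1" and "n \<ge> 2"
    and "x \<in> planar_desargues_at I"
  shows "(n = 2 \<longrightarrow> fundamental_group (planar_desargues_at I) x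
             \<cong> integer_group \<times>\<times> integer_group \<times>\<times> integer_group) \<and>
         (n \<ge> 3 \<longrightarrow> fundamental_group (planar_desargues_at I) x
             \<cong> integer_group \<times>\<times> integer_group)"
proof -
  obtain e where e: "e \<noteq> 0" "I = cproj_of e"
    by (rule cproj_cases)
  let ?X = "{(v, w). indep3 e v w}"
  have hom: "homeomorphism (planar_desargues_at I) (desargues_params e) (params_of_desargues e) (desargues_of_params e)"
    unfolding e(2) by (rule homeomorphism_symD[OF homeomorphism_desargues_of_params[OF e(1)]])
  obtain \<alpha> \<beta> p \<gamma> where y: "params_of_desargues e x = (\<alpha>, \<beta>, p, \<gamma>)"
    by (metis prod.collapse)
  have "params_of_desargues e x \<in> desargues_params e"
    using hom assms(3) by (auto simp: homeomorphism_def)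
  then have nz: "\<alpha> \<noteq> 0" "\<beta> \<noteq> 0" and p: "p \<in> ?X"
    by (auto simp: y desargues_params_def)
  have base: "fundamental_group (planar_desargues_at I) x
      \<cong> fundamental_group ((- {0}) \<times> (- {0}) \<times> ?X \<times> UNIV) (\<alpha>, \<beta>, p, \<gamma>)"
    using fundamental_group_homeomorphic[OF hom assms(3)] unfolding y desargues_params_def .
  have UNIV: "simply_connected (UNIV :: complex set)"
    by (simp add: convex_imp_simply_connected)
  have plane: "fundamental_group (planar_desargues_at I) x
      \<cong> integer_group \<times>\<times> integer_group \<times>\<times> integer_group" if "n = 2"
  proof -
    have "fundamental_group (?X \<times> UNIV) (p, \<gamma>) \<cong> fundamental_group ?X p"
      by (rule fundamental_group_Times_simply_connected[OF UNIV]) simp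
    also have "fundamental_group ?X p \<cong> integer_group"
      using assms(1) that p by (intro fundamental_group_indep3) auto
    finally have X: "fundamental_group (?X \<times> UNIV) (p, \<gamma>) \<cong> integer_group" .
    have "fundamental_group ((- {0}) \<times> ?X \<times> UNIV) (\<beta>, p, \<gamma>) \<cong> integer_group \<times>\<times> integer_group"
      by (rule iso_trans[OF fundamental_group_Times DirProd_iso_cong[OF fundamental_group_punctured_plane[OF nz(2)] X]])
    then have "fundamental_group ((- {0}) \<times> (- {0}) \<times> ?X \<times> UNIV) (\<alpha>, \<beta>, p, \<gamma>)
        \<cong> integer_group \<times>\<times> integer_group \<times>\<times> integer_group"
      by (rule iso_trans[OF fundamental_group_Times DirProd_iso_cong[OF fundamental_group_punctured_plane[OF nz(1)]]])
    then show ?thesis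
      by (rule iso_trans[OF base])
  qed
  have space: "fundamental_group (planar_desargues_at I) x \<cong> integer_group \<times>\<times> integer_group"
    if "n \<ge> 3"
  proof -
    from that have "simply_connected ?X"
      using assms(1) e(1) by (intro simply_connected_indep3) auto
    then have sc: "simply_connected (?X \<times> (UNIV :: complex set))"
      using UNIV by (rule simply_connected_Times)
    have "fundamental_group ((- {0}) \<times> ?X \<times> UNIV) (\<beta>, p, \<gamma>) \<cong> fundamental_group (- {0}) \<beta>"
      using p by (intro fundamental_group_Times_simply_connected[OF sc]) simp
    also have "fundamental_group (- {0}) \<beta> \<cong> integer_group"
      by (rule fundamental_group_punctured_plane[OF nz(2)])
    finally have "fundamental_group ((- {0}) \<times> (- {0}) \<times> ?X \<times> UNIV) (\<alpha>, \<beta>, p, \<gamma>)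
        \<cong> integer_group \<times>\<times> integer_group"
      by (rule iso_trans[OF fundamental_group_Times DirProd_iso_cong[OF fundamental_group_punctured_plane[OF nz(1)]]])
    then show ?thesis
      by (rule iso_trans[OF base])
  qed
  \<comment> \<open>planarity of the configuration \<open>x\<close>, read off from representing vectors\<close>
  obtain A1 B1 A2 B2 A3 B3 where x: "x = (A1, B1, A2, B2, A3, B3)"
    by (metis prod.collapse)
  have "\<exists>a1 a2 a3. A1 = cproj_of a1 \<and> A2 = cproj_of a2 \<and> A3 = cproj_of a3 \<and>
      a3 \<in> vec.span {e, a1, a2}"
    using e(1) assms(3) unfolding x e(2) by (metis planar_desargues_at_iff)
  show ?thesis
    using plane space by blast
qed

end
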